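(* Let $a=\sum_{i} c_iF_i$ be a quantum graph (a finite formal real linear combination of simple graphs). Then $a$ is nonnegative, i.e. $\sum_i c_i\, t(F_i,G)\ge 0$ for every simple graph $G$, if and only if for every $\epsilon>0$ there exist an integer $k\ge 0$ and a sum of squares $\sigma\in\Sigma^2\mathcal A_k^0$ such that $a+\epsilon$ and $\sigma$ coincide up to labels and isolated vertices.
   Context: All graphs are finite, undirected, without multiple edges and without loops. For graphs $F,G$, the homomorphism density is $t(F,G)=\hom(F,G)/|V_G|^{|V_F|}$, where $\hom(F,G)$ is the number of maps $\varphi:V_F\to V_G$ such that $\varphi(i)\varphi(j)\in E_G$ whenever $ij\in E_F$. A $k$-labeled graph is a graph in which $k$ different vertices are labeled $1,\dots,k$ (a $0$-labeled graph is an unlabeled graph). Let $\mathcal G_k$ be the set of isomorphism classes (respecting labels) of $k$-labeled graphs. The product of $F,G\in\mathcal G_k$ is obtained by taking the disjoint union, identifying vertices with the same label, and reducing edge multiplicities to one. This makes $\mathcal G_k$ an abelian monoid whose identity is the graph with vertices $1,\dots,k$ and no edges (the empty graph if $k=0$). Let $\mathcal A_k$ be the monoid algebra of $\mathcal G_k$ over $\mathbb R$; quantum graphs are the elements of $\mathcal A_0$. Let $\mathcal A_k^0\subseteq\mathcal A_k$ be the subalgebra spanned by the $k$-labeled graphs all of whose vertices are labeled; it is isomorphic to $\mathbb R[z_{ij}\mid 1\le i<j\le k]/(z_{ij}^2-z_{ij})$, where $z_{ij}$ is the graph on the labeled vertices $1,\dots,k$ whose only edge is $ij$. $\Sigma^2\mathcal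 A_k^0$ denotes the set of finite sums of squares of elements of $\mathcal A_k^0$. In $a+\epsilon$, the number $\epsilon$ stands for $\epsilon$ times the identity element of $\mathcal A_0$. Two elements of (possibly different) algebras $\mathcal A_k,\mathcal A_l$ coincide up to labels and isolated vertices if, after forgetting all labels (giving elements of $\mathcal A_0$), they become equal when each graph is identified with every graph obtained from it by adding or removing isolated vertices; i.e. they are equal modulo the linear span of all $G\sqcup K_1-G$, where $G$ ranges over unlabeled graphs (including the empty graph) and $K_1$ is the one-vertex graph. *)

theory Defs
  imports "HOL-Analysis.Analysis" "HOL-Library.Poly_Mapping"
begin

section \<open>Labeled graphs\<close>

text \<open>
  A finite simple graph with vertices in \<^typ>\<open>nat\<close>, edges as two-element sets, and a list of
  labeled vertices: the \<open>i\<close>-th entry of the list is the vertex carrying the label \<open>i\<close>, so that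
  \<open>k\<close>-labeled graphs have a list of length \<open>k\<close>, and unlabeled graphs have an empty list.
\<close>

datatype pregraph = Pregraph (verts: "nat set") (edges: "nat set set") (labs: "nat list")

definition wf_graph :: "pregraph \<Rightarrow> bool" where
  "wf_graph A \<longleftrightarrow> finite (verts A) \<and> (\<forall>e\<in>edges A. e \<subseteq> verts A \<and> card e = 2)
     \<and> distinct (labs A) \<and> set (labs A) \<subseteq> verts A"

definition graph_iso :: "pregraph \<Rightarrow> pregraph \<Rightarrow> bool" where
  "graph_iso A B \<longleftrightarrow> wf_graph A \<and> wf_graph B \<and>
     (\<exists>f. bij_betw f (verts A) (verts B) \<and> (`) f ` edges A = edges B \<and> map f (labs A) = labs B)"

text \<open>
  The product of labeled graphs: the vertex \<open>v\<close> of \<open>A\<close> becomes \<open>2 * v\<close>; the vertex \<open>v\<close> of \<open>B\<close>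
  becomes the image of the vertex of \<open>A\<close> with the same label, if there is one, and \<open>2 * v + 1\<close>
  otherwise.  If \<open>A\<close> and \<open>B\<close> have the same number of labels, this is the product of
  \<open>\<G>\<^sub>k\<close>.  For graphs with different numbers of labels, the labels that occur in both are
  identified and all labels are kept; this makes all \<open>\<G>\<^sub>k\<close> subsemigroups of a single monoid.
\<close>

definition glue_right :: "pregraph \<Rightarrow> pregraph \<Rightarrow> nat \<Rightarrow> nat" where
  "glue_right A B v = (case map_of (zip (labs B) (labs A)) v of Some u \<Rightarrow> 2 * u | None \<Rightarrow> 2 * v + 1)"

definition glue :: "pregraph \<Rightarrow> pregraph \<Rightarrow> pregraph" where
  "glue A B = Pregraph ((\<lambda>v. 2 * v) ` verts A \<union> glue_right A B ` verts B)
     ((`) (\<lambda>v. 2 * v) ` edges A \<union> (`) (glue_right A B) ` edges B)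
     (map (\<lambda>v. 2 * v) (labs A) @ map (glue_right A B) (drop (length (labs A)) (labs B)))"

definition hom_count :: "pregraph \<Rightarrow> pregraph \<Rightarrow> nat" where
  "hom_count A B = card {\<phi> \<in> verts A \<rightarrow>\<^sub>E verts B.
     \<forall>i\<in>verts A. \<forall>j\<in>verts A. {i, j} \<in> edges A \<longrightarrow> {\<phi> i, \<phi> j} \<in> edges B}"


subsection \<open>Isomorphism is a congruence\<close>

lemma graph_iso_refl: "wf_graph A \<Longrightarrow> graph_iso A A"
  unfolding graph_iso_def by (auto intro!: exI[of _ id])

lemma graph_iso_wf: "graph_iso A B \<Longrightarrow> wf_graph A"
  unfolding graph_iso_def by blast

lemma graph_iso_sym:
  assumes "graph_iso A B" shows "graph_iso B A"
proof -
  obtain f where wf: "wf_graph A" "wf_graph B" and f: "bij_betw f (verts A) (verts B)"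
    "(`) f ` edges A = edges B" "map f (labs A) = labs B"
    using assms unfolding graph_iso_def by blast
  let ?g = "inv_into (verts A) f"
  have inj: "inj_on f (verts A)" using f(1) by (rule bij_betw_imp_inj_on)
  have gf: "?g ` f ` e = e" if "e \<in> edges A" for e
    using that wf(1) inj by (simp add: wf_graph_def inv_into_image_cancel)
  have "(`) ?g ` (`) f ` edges A = edges A"
    using gf by (auto simp: image_iff)
  moreover have "map ?g (map f (labs A)) = labs A"
    using wf(1) inj by (auto simp: wf_graph_def intro!: map_idI inv_into_f_f)
  ultimately show ?thesis
    unfolding graph_iso_def using wf bij_betw_inv_into[OF f(1)] f(2,3) by metis
qed

lemma graph_iso_trans:
  assumes "graph_iso A B" "graph_iso B C" shows "graph_iso A C"
proof -
  obtain f where f: "bij_betw f (verts A) (verts B)"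
    "(`) f ` edges A = edges B" "map f (labs A) = labs B"
    using assms(1) unfolding graph_iso_def by blast
  obtain g where g: "bij_betw g (verts B) (verts C)"
    "(`) g ` edges B = edges C" "map g (labs B) = labs C"
    using assms(2) unfolding graph_iso_def by blast
  have "bij_betw (g \<circ> f) (verts A) (verts C)" by (rule bij_betw_trans[OF f(1) g(1)])
  moreover have "(`) (g \<circ> f) ` edges A = edges C"
    unfolding g(2)[symmetric] f(2)[symmetric] by (simp add: image_image)
  moreover have "map (g \<circ> f) (labs A) = labs C"
    unfolding g(3)[symmetric] f(3)[symmetric] by simp
  moreover have "wf_graph A" "wf_graph C" using assms unfolding graph_iso_def by blast+
  ultimately show ?thesis unfolding graph_iso_def by metis
qed

text \<open>
  \<open>C\<close> is obtained from the graphs \<open>A i\<close> by identifying the vertices with the same label, where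
  \<open>f i\<close> maps the vertices of \<open>A i\<close> to those of \<open>C\<close>.
\<close>

definition glued :: "'i set \<Rightarrow> ('i \<Rightarrow> pregraph) \<Rightarrow> ('i \<Rightarrow> nat \<Rightarrow> nat) \<Rightarrow> pregraph \<Rightarrow> bool" where
  "glued I A f C \<longleftrightarrow> (\<forall>i\<in>I. wf_graph (A i)) \<and> verts C = (\<Union>i\<in>I. f i ` verts (A i))
     \<and> edges C = (\<Union>i\<in>I. (`) (f i) ` edges (A i))
     \<and> (\<forall>i\<in>I. \<forall>j\<in>I. \<forall>a\<in>verts (A i). \<forall>b\<in>verts (A j). f i a = f j b \<longleftrightarrow> (i = j \<and> a = b) \<or>
         (\<exists>n. n < length (labs (A i)) \<and> n < length (labs (A j)) \<and> a = labs (A i) ! n \<and> b = labs (A j) ! n))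
     \<and> (\<forall>i\<in>I. \<forall>n<length (labs (A i)). n < length (labs C) \<and> labs C ! n = f i (labs (A i) ! n))
     \<and> (\<forall>n<length (labs C). \<exists>i\<in>I. n < length (labs (A i)))"

lemma gluedD:
  assumes "glued I A f C"
  shows "\<And>i. i \<in> I \<Longrightarrow> wf_graph (A i)"
    and "verts C = (\<Union>i\<in>I. f i ` verts (A i))"
    and "edges C = (\<Union>i\<in>I. (`) (f i) ` edges (A i))"
    and "\<And>i j a b. \<lbrakk>i \<in> I; j \<in> I; a \<in> verts (A i); b \<in> verts (A j)\<rbrakk> \<Longrightarrow>
      f i a = f j b \<longleftrightarrow> (i = j \<and> a = b) \<or>
         (\<exists>n. n < length (labs (A i)) \<and> n < length (labs (A j)) \<and> a = labs (A i) ! n \<and> b = labs (A j) ! n)"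
    and "\<And>i n. \<lbrakk>i \<in> I; n < length (labs (A i))\<rbrakk> \<Longrightarrow> n < length (labs C)"
    and "\<And>i n. \<lbrakk>i \<in> I; n < length (labs (A i))\<rbrakk> \<Longrightarrow> labs C ! n = f i (labs (A i) ! n)"
    and "\<And>n. n < length (labs C) \<Longrightarrow> \<exists>i\<in>I. n < length (labs (A i))"
proof -
  note * = assms[unfolded glued_def]
  note c2 = *[THEN conjunct2] and c3 = *[THEN conjunct2, THEN conjunct2]
  note c4 = c3[THEN conjunct2] and c5 = c3[THEN conjunct2, THEN conjunct2]
  note c6 = c5[THEN conjunct2]
  show "\<And>i. i \<in> I \<Longrightarrow> wf_graph (A i)" by (rule *[THEN conjunct1, rule_format])
  show "verts C = (\<Union>i\<in>I. f i ` verts (A i))" by (rule c2[THEN conjunct1])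
  show "edges C = (\<Union>i\<in>I. (`) (f i) ` edges (A i))" by (rule c3[THEN conjunct1])
  show "\<And>i j a b. \<lbrakk>i \<in> I; j \<in> I; a \<in> verts (A i); b \<in> verts (A j)\<rbrakk> \<Longrightarrow>
      f i a = f j b \<longleftrightarrow> (i = j \<and> a = b) \<or>
         (\<exists>n. n < length (labs (A i)) \<and> n < length (labs (A j)) \<and> a = labs (A i) ! n \<and> b = labs (A j) ! n)"
    by (rule c4[THEN conjunct1, rule_format])
  show "\<And>i n. \<lbrakk>i \<in> I; n < length (labs (A i))\<rbrakk> \<Longrightarrow> n < length (labs C)"
    by (rule c5[THEN conjunct1, rule_format, THEN conjunct1])
  show "\<And>i n. \<lbrakk>i \<in> I; n < length (labs (A i))\<rbrakk> \<Longrightarrow> labs C ! n = f i (labs (A i) ! n)"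
    by (rule c5[THEN conjunct1, rule_format, THEN conjunct2])
  show "\<And>n. n < length (labs C) \<Longrightarrow> \<exists>i\<in>I. n < length (labs (A i))"
    by (rule c6[THEN spec, THEN mp])
qed

lemma wf_nth_verts: "wf_graph A \<Longrightarrow> n < length (labs A) \<Longrightarrow> labs A ! n \<in> verts A"
  unfolding wf_graph_def using nth_mem by blast

lemma wf_nth_eq:
  "wf_graph A \<Longrightarrow> n < length (labs A) \<Longrightarrow> m < length (labs A) \<Longrightarrow> labs A ! n = labs A ! m \<longleftrightarrow> n = m"
  unfolding wf_graph_def by (simp add: nth_eq_iff_index_eq)

lemma glued_inj:
  assumes "glued I A f C" "i \<in> I" shows "inj_on (f i) (verts (A i))"
  using gluedD(4)[OF assms(1) assms(2) assms(2)] by (auto intro!: inj_onI)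

lemma glued_wf:
  assumes "glued I A f C" "finite I"
  shows "wf_graph C"
proof -
  note D = gluedD[OF assms(1)]
  have "finite (verts C)" unfolding D(2) using assms(2) D(1) by (auto simp: wf_graph_def)
  moreover have "e \<subseteq> verts C \<and> card e = 2" if e: "e \<in> edges C" for e
  proof -
    obtain i d where i: "i \<in> I" "d \<in> edges (A i)" "e = f i ` d" using e unfolding D(3) by blast
    have d: "d \<subseteq> verts (A i)" "card d = 2" using D(1)[OF i(1)] i(2) by (auto simp: wf_graph_def)
    have "inj_on (f i) d" using glued_inj[OF assms(1) i(1)] d(1) inj_on_subset by blast
    then show ?thesis using d i card_image[of "f i" d] unfolding D(2) by auto
  qed
  moreover have "distinct (labs C)" unfolding distinct_conv_nth
  proof (intro allI impI)
    fix n m assume nm: "n < length (labs C)" "m < length (labs C)" "n \<noteq> m"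
    obtain i j where i: "i \<in> I" "n < length (labs (A i))" and j: "j \<in> I" "m < length (labs (A j))"
      using D(7) nm by meson
    note wi = D(1)[OF i(1)] and wj = D(1)[OF j(1)]
    show "labs C ! n \<noteq> labs C ! m"
    proof
      assume "labs C ! n = labs C ! m"
      then have "f i (labs (A i) ! n) = f j (labs (A j) ! m)"
        using D(6)[OF i] D(6)[OF j] by simp
      then consider "i = j" "labs (A i) ! n = labs (A j) ! m"
        | k where "k < length (labs (A i))" "k < length (labs (A j))"
          "labs (A i) ! n = labs (A i) ! k" "labs (A j) ! m = labs (A j) ! k"
        using D(4)[OF i(1) j(1) wf_nth_verts[OF wi i(2)] wf_nth_verts[OF wj j(2)]] by blast
      then show False
        using wf_nth_eq[OF wi] wf_nth_eq[OF wj] i(2) j(2) nm(3) by cases metis+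
    qed
  qed
  moreover have "set (labs C) \<subseteq> verts C"
  proof
    fix x assume "x \<in> set (labs C)"
    then obtain n where n: "n < length (labs C)" "x = labs C ! n" by (auto simp: in_set_conv_nth)
    then obtain i where i: "i \<in> I" "n < length (labs (A i))" using D(7) by blast
    show "x \<in> verts C" unfolding n(2) D(6)[OF i] D(2)
      using i wf_nth_verts[OF D(1)[OF i(1)] i(2)] by blast
  qed
  ultimately show ?thesis unfolding wf_graph_def by blast
qed

lemma glued_unique:
  assumes g: "glued I A f C" and g': "glued I A' f' C'" and fin: "finite I"
    and iso: "\<And>i. i \<in> I \<Longrightarrow> graph_iso (A i) (A' i)"
  shows "graph_iso C C'"
proof -
  note D = gluedD[OF g] and D' = gluedD[OF g']
  have "\<forall>i\<in>I. \<exists>p. bij_betw p (verts (A i)) (verts (A' i)) \<and> (`) p ` edges (A i) = edges (A' i)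
      \<and> map p (labs (A i)) = labs (A' i)"
    using iso unfolding graph_iso_def by blast
  from bchoice[OF this] obtain p where p': "\<forall>i\<in>I. bij_betw (p i) (verts (A i)) (verts (A' i))
      \<and> (`) (p i) ` edges (A i) = edges (A' i) \<and> map (p i) (labs (A i)) = labs (A' i)" ..
  have p: "\<And>i. i \<in> I \<Longrightarrow> bij_betw (p i) (verts (A i)) (verts (A' i))"
    "\<And>i. i \<in> I \<Longrightarrow> (`) (p i) ` edges (A i) = edges (A' i)"
    "\<And>i. i \<in> I \<Longrightarrow> map (p i) (labs (A i)) = labs (A' i)"
    using p' by simp_all
  have len: "length (labs (A' i)) = length (labs (A i))" if "i \<in> I" for i
    using p(3)[OF that] by (metis length_map)
  have nth: "labs (A' i) ! n = p i (labs (A i) ! n)" if "i \<in> I" "n < length (labs (A i))" for i n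
    using p(3)[OF that(1)] that(2) by (metis nth_map)
  have pv: "p i a \<in> verts (A' i)" if "i \<in> I" "a \<in> verts (A i)" for i a
    using p(1)[OF that(1)] that(2) by (rule bij_betwE[rule_format])
  have peq: "p i a = p i b \<longleftrightarrow> a = b" if "i \<in> I" "a \<in> verts (A i)" "b \<in> verts (A i)" for i a b
    using bij_betw_imp_inj_on[OF p(1)[OF that(1)]] that(2,3) by (simp add: inj_on_eq_iff)
  have key: "f i a = f j b \<longleftrightarrow> f' i (p i a) = f' j (p j b)"
    if h: "i \<in> I" "j \<in> I" "a \<in> verts (A i)" "b \<in> verts (A j)" for i j a b
  proof -
    have "p i a = labs (A' i) ! n \<longleftrightarrow> a = labs (A i) ! n" if "n < length (labs (A i))" for n
      using nth[OF h(1) that] peq[OF h(1,3) wf_nth_verts[OF D(1)[OF h(1)] that]] by simp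
    moreover have "p j b = labs (A' j) ! n \<longleftrightarrow> b = labs (A j) ! n" if "n < length (labs (A j))" for n
      using nth[OF h(2) that] peq[OF h(2,4) wf_nth_verts[OF D(1)[OF h(2)] that]] by simp
    moreover have "i = j \<and> p i a = p j b \<longleftrightarrow> i = j \<and> a = b" using peq h by auto
    ultimately show ?thesis
      unfolding D(4)[OF h] D'(4)[OF h(1,2) pv[OF h(1,3)] pv[OF h(2,4)]] len[OF h(1)] len[OF h(2)]
      by blast
  qed
  define h where "h c = (let (i, a) = (SOME (i, a). i \<in> I \<and> a \<in> verts (A i) \<and> c = f i a) in f' i (p i a))" for c
  have h: "h (f i a) = f' i (p i a)" if ia: "i \<in> I" "a \<in> verts (A i)" for i a
  proof -
    define x where "x = (SOME (j, b). j \<in> I \<and> b \<in> verts (A j) \<and> f i a = f j b)"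
    have "case x of (j, b) \<Rightarrow> j \<in> I \<and> b \<in> verts (A j) \<and> f i a = f j b"
      unfolding x_def by (rule someI[of _ "(i, a)"]) (use ia in auto)
    then obtain j b where x: "x = (j, b)" "j \<in> I" "b \<in> verts (A j)" "f i a = f j b" by (cases x) auto
    have "h (f i a) = f' j (p j b)" unfolding h_def x_def[symmetric] x(1) by simp
    then show ?thesis using key[OF ia(1) x(2) ia(2) x(3)] x(4) by simp
  qed
  have img: "h ` f i ` S = f' i ` p i ` S" if "i \<in> I" "S \<subseteq> verts (A i)" for i S
    using h[OF that(1)] that(2) by (auto simp: image_iff subset_iff)
  have "bij_betw h (verts C) (verts C')"
  proof (rule bij_betwI')
    fix c d assume "c \<in> verts C" "d \<in> verts C"
    then obtain i a j b where "i \<in> I" "a \<in> verts (A i)" "c = f i a" "j \<in> I" "b \<in> verts (A j)" "d = f j b"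
      unfolding D(2) by blast
    then show "(h c = h d) = (c = d)" using key h by simp
  next
    fix c assume "c \<in> verts C"
    then obtain i a where "i \<in> I" "a \<in> verts (A i)" "c = f i a" unfolding D(2) by blast
    then show "h c \<in> verts C'" using h pv unfolding D'(2) by (metis UN_I imageI)
  next
    fix c assume "c \<in> verts C'"
    then obtain i a where i: "i \<in> I" "a \<in> verts (A' i)" "c = f' i a" unfolding D'(2) by blast
    have "a \<in> p i ` verts (A i)" using p(1)[OF i(1)] i(2) by (simp add: bij_betw_def)
    then obtain b where b: "b \<in> verts (A i)" "a = p i b" by blast
    show "\<exists>x\<in>verts C. c = h x"
    proof
      show "c = h (f i b)" using h[OF i(1) b(1)] i(3) b(2) by simp
      show "f i b \<in> verts C" unfolding D(2) using i(1) b(1) by blast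
    qed
  qed
  moreover have "(`) h ` edges C = edges C'"
  proof -
    have "(`) h ` (`) (f i) ` edges (A i) = (`) (f' i) ` edges (A' i)" if i: "i \<in> I" for i
    proof -
      have "h ` f i ` e = f' i ` p i ` e" if "e \<in> edges (A i)" for e
        using img[OF i, of e] D(1)[OF i] that unfolding wf_graph_def by simp
      then have "(\<lambda>e. h ` f i ` e) ` edges (A i) = (\<lambda>e. f' i ` p i ` e) ` edges (A i)"
        by (rule image_cong[OF refl])
      then show ?thesis unfolding p(2)[OF i, symmetric] image_image .
    qed
    then show ?thesis unfolding D(3) D'(3) image_UN by (rule SUP_cong[OF refl])
  qed
  moreover have "map h (labs C) = labs C'"
  proof (rule nth_equalityI)
    have lt: "n < length (labs C) \<longleftrightarrow> n < length (labs C')" for n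
    proof
      assume "n < length (labs C)"
      then obtain i where i: "i \<in> I" "n < length (labs (A i))" using D(7) by blast
      show "n < length (labs C')" by (rule D'(5)[OF i(1)]) (use i len in simp)
    next
      assume "n < length (labs C')"
      then obtain i where i: "i \<in> I" "n < length (labs (A' i))" using D'(7) by blast
      show "n < length (labs C)" by (rule D(5)[OF i(1)]) (use i len in simp)
    qed
    show "length (map h (labs C)) = length (labs C')"
      using lt[of "length (labs C)"] lt[of "length (labs C')"] unfolding length_map by linarith
    fix n assume "n < length (map h (labs C))"
    then have n: "n < length (labs C)" by simp
    then obtain i where i: "i \<in> I" "n < length (labs (A i))" using D(7) by blast
    have "labs C' ! n = f' i (labs (A' i) ! n)" using D'(6)[OF i(1)] len i by simp
    then show "map h (labs C) ! n = labs C' ! n"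
      using n nth[OF i] D(6)[OF i] h[OF i(1) wf_nth_verts[OF D(1)[OF i(1)] i(2)]] by simp
  qed
  ultimately show ?thesis
    unfolding graph_iso_def using glued_wf[OF g fin] glued_wf[OF g' fin] by blast
qed

lemma glue_right_label:
  assumes "wf_graph B" "n < length (labs A)" "n < length (labs B)"
  shows "glue_right A B (labs B ! n) = 2 * labs A ! n"
proof -
  have "map_of (zip (labs B) (labs A)) (labs B ! n) = Some (labs A ! n)"
    using assms by (intro map_of_is_SomeI) (auto simp: wf_graph_def in_set_zip map_fst_zip_take)
  then show ?thesis by (simp add: glue_right_def)
qed

lemma glue_right_other:
  assumes "\<not> (\<exists>n. n < length (labs A) \<and> n < length (labs B) \<and> v = labs B ! n)"
  shows "glue_right A B v = 2 * v + 1"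
proof -
  have "map_of (zip (labs B) (labs A)) v = None"
    using assms by (auto simp: map_of_eq_None_iff in_set_zip)
  then show ?thesis by (simp add: glue_right_def)
qed

lemma glued_glue:
  assumes A: "wf_graph A" and B: "wf_graph B"
  shows "glued UNIV (\<lambda>i. if i then A else B) (\<lambda>i. if i then (\<lambda>v. 2 * v) else glue_right A B) (glue A B)"
proof -
  let ?g = "glue_right A B"
  have vcases: "(\<exists>n. n < length (labs A) \<and> n < length (labs B) \<and> b = labs B ! n \<and> ?g b = 2 * labs A ! n)
     \<or> ?g b = 2 * b + 1 \<and> \<not> (\<exists>n. n < length (labs A) \<and> n < length (labs B) \<and> b = labs B ! n)" for b
  proof (cases "\<exists>n. n < length (labs A) \<and> n < length (labs B) \<and> b = labs B ! n")
    case True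
    then obtain n where n: "n < length (labs A)" "n < length (labs B)" "b = labs B ! n" by blast
    show ?thesis
      by (intro disjI1 exI[of _ n]) (use n glue_right_label[OF B n(1,2)] in simp)
  next
    case False
    then show ?thesis using glue_right_other[OF False] by blast
  qed
  have AA: "2 * a = 2 * b \<longleftrightarrow> a = b \<or> (\<exists>n<length (labs A). a = labs A ! n \<and> b = labs A ! n)" for a b :: nat
    by auto
  have AB: "2 * a = ?g b \<longleftrightarrow> (\<exists>n. n < length (labs A) \<and> n < length (labs B) \<and> a = labs A ! n \<and> b = labs B ! n)"
    for a b
    using vcases[of b]
  proof (elim disjE exE conjE)
    fix n assume n: "n < length (labs A)" "n < length (labs B)" "b = labs B ! n" "?g b = 2 * labs A ! n"
    show ?thesis
    proof
      assume "2 * a = ?g b"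
      then have "a = labs A ! n" using n(4) by simp
      then show "\<exists>n. n < length (labs A) \<and> n < length (labs B) \<and> a = labs A ! n \<and> b = labs B ! n"
        using n(1-3) by blast
    next
      assume "\<exists>n. n < length (labs A) \<and> n < length (labs B) \<and> a = labs A ! n \<and> b = labs B ! n"
      then obtain m where m: "m < length (labs B)" "a = labs A ! m" "b = labs B ! m" by blast
      have "n = m" using wf_nth_eq[OF B n(2) m(1)] n(3) m(3) by simp
      then show "2 * a = ?g b" using n(4) m(2) by simp
    qed
  next
    assume g: "?g b = 2 * b + 1"
      and no: "\<not> (\<exists>n. n < length (labs A) \<and> n < length (labs B) \<and> b = labs B ! n)"
    have "2 * a \<noteq> ?g b" unfolding g by presburger
    then show ?thesis using no by blast
  qed
  have inj: "a = b" if eq: "?g a = ?g b" for a b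
    using vcases[of a]
  proof (elim disjE exE conjE)
    fix n assume n: "n < length (labs A)" "a = labs B ! n" "?g a = 2 * labs A ! n"
    show ?thesis using vcases[of b]
    proof (elim disjE exE conjE)
      fix m assume m: "m < length (labs A)" "b = labs B ! m" "?g b = 2 * labs A ! m"
      have "n = m" using wf_nth_eq[OF A n(1) m(1)] n(3) m(3) eq by simp
      then show ?thesis using n(2) m(2) by simp
    next
      assume "?g b = 2 * b + 1"
      then show ?thesis using eq n(3) by presburger
    qed
  next
    assume a: "?g a = 2 * a + 1"
    show ?thesis using vcases[of b]
    proof (elim disjE exE conjE)
      fix m assume "?g b = 2 * labs A ! m"
      then show ?thesis using eq a by presburger
    next
      assume "?g b = 2 * b + 1"
      then show ?thesis using eq a by simp
    qed
  qed
  have BB: "?g a = ?g b \<longleftrightarrow> a = b \<or> (\<exists>n<length (labs B). a = labs B ! n \<and> b = labs B ! n)" for a b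
    using inj by auto
  have L: "n < length (labs (glue A B)) \<longleftrightarrow> n < length (labs A) \<or> n < length (labs B)" for n
    by (auto simp: glue_def)
  have LA: "labs (glue A B) ! n = 2 * labs A ! n" if "n < length (labs A)" for n
    using that by (simp add: glue_def nth_append)
  have LB: "labs (glue A B) ! n = ?g (labs B ! n)" if "n < length (labs B)" for n
    using that glue_right_label[OF B _ that] by (auto simp: glue_def nth_append)
  have AB': "?g b = 2 * a \<longleftrightarrow> (\<exists>n. n < length (labs B) \<and> n < length (labs A) \<and> b = labs B ! n \<and> a = labs A ! n)"
    for a b using AB[of a b] by metis
  have V: "verts (glue A B) = (\<lambda>v. 2 * v) ` verts A \<union> ?g ` verts B"
    "edges (glue A B) = (`) (\<lambda>v. 2 * v) ` edges A \<union> (`) ?g ` edges B"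
    by (simp_all add: glue_def)
  have ball: "(\<forall>i\<in>UNIV. P i) \<longleftrightarrow> P True \<and> P False" "(\<exists>i\<in>UNIV. P i) \<longleftrightarrow> P True \<or> P False" for P
    by (auto simp: UNIV_bool)
  have UN: "(\<Union>i\<in>UNIV. X i) = X True \<union> X False" for X :: "bool \<Rightarrow> 'x set"
    by (auto simp: UNIV_bool)
  show ?thesis
    unfolding glued_def V ball UN if_True if_False simp_thms
    by (intro conjI ballI allI impI A B refl AB AB' BB AA)
      (simp_all add: L LA LB)
qed

lemma wf_glue: "wf_graph A \<Longrightarrow> wf_graph B \<Longrightarrow> wf_graph (glue A B)"
  using glued_wf[OF glued_glue] by simp

lemma glue_cong: "graph_iso A A' \<Longrightarrow> graph_iso B B' \<Longrightarrow> graph_iso (glue A B) (glue A' B')"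
  by (rule glued_unique[OF glued_glue glued_glue]) (auto simp: graph_iso_def)

lemma glued_reindex:
  assumes "glued I A f C" "bij_betw \<pi> J I"
  shows "glued J (A \<circ> \<pi>) (f \<circ> \<pi>) C"
proof -
  note D = gluedD[OF assms(1)]
  have I: "I = \<pi> ` J" and inj: "\<And>i j. i \<in> J \<Longrightarrow> j \<in> J \<Longrightarrow> \<pi> i = \<pi> j \<longleftrightarrow> i = j"
    using assms(2) by (auto simp: bij_betw_def inj_on_eq_iff)
  show ?thesis
    unfolding glued_def o_def
    apply (intro conjI)
    subgoal using D(1) I by blast
    subgoal using D(2) I by auto
    subgoal using D(3) I by auto
    subgoal using D(4) I inj by (metis imageI)
    subgoal using D(5,6) I by blast
    subgoal using D(7) I by blast
    done
qed

lemma glue_comm: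
  assumes "wf_graph A" "wf_graph B" shows "graph_iso (glue A B) (glue B A)"
proof (rule glued_unique[OF glued_glue[OF assms] glued_reindex[OF glued_glue[OF assms(2,1)], of Not UNIV]])
  show "bij Not" by (rule involuntory_imp_bij) simp
qed (use assms in \<open>auto intro: graph_iso_refl\<close>)

lemma glued_glue3:
  assumes A: "wf_graph A" and B: "wf_graph B" and C: "wf_graph C"
  shows "\<exists>f. glued {..<3::nat} (\<lambda>i. [A, B, C] ! i) f (glue (glue A B) C)"
proof -
  let ?AB = "glue A B"
  define g where "g = glue_right A B"
  define h where "h = glue_right ?AB C"
  let ?p = "\<lambda>v. 2 * (2 * v :: nat)" and ?q = "\<lambda>v. 2 * g v"
  note AB = wf_glue[OF A B]
  note D = gluedD[OF glued_glue[OF A B], folded g_def]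
  note E = gluedD[OF glued_glue[OF AB C], folded h_def]
  have V: "verts ?AB = (\<lambda>v. 2 * v) ` verts A \<union> g ` verts B"
    "edges ?AB = (`) (\<lambda>v. 2 * v) ` edges A \<union> (`) g ` edges B"
    "verts (glue ?AB C) = (\<lambda>v. 2 * v) ` verts ?AB \<union> h ` verts C"
    "edges (glue ?AB C) = (`) (\<lambda>v. 2 * v) ` edges ?AB \<union> (`) h ` edges C"
    by (simp_all add: glue_def g_def h_def)
  have LAB: "n < length (labs ?AB) \<longleftrightarrow> n < length (labs A) \<or> n < length (labs B)" for n
    by (auto simp: glue_def)
  have LABC: "n < length (labs (glue ?AB C)) \<longleftrightarrow> n < length (labs A) \<or> n < length (labs B) \<or> n < length (labs C)" for n
    by (auto simp: glue_def)
  have LA: "labs ?AB ! n = 2 * labs A ! n" if "n < length (labs A)" for n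
    using D(6)[of True n] that by simp
  have LB: "labs ?AB ! n = g (labs B ! n)" if "n < length (labs B)" for n
    using D(6)[of False n] that by simp
  have MA: "labs (glue ?AB C) ! n = 2 * labs ?AB ! n" if "n < length (labs ?AB)" for n
    using E(6)[of True n] that by simp
  have MC: "labs (glue ?AB C) ! n = h (labs C ! n)" if "n < length (labs C)" for n
    using E(6)[of False n] that by simp
  have vA: "2 * a \<in> verts ?AB" if "a \<in> verts A" for a using that V by auto
  have vB: "g a \<in> verts ?AB" if "a \<in> verts B" for a using that V by auto
  let ?R = "\<lambda>X Y a b. \<exists>n. n < length (labs X) \<and> n < length (labs Y) \<and> a = labs X ! n \<and> b = labs Y ! n"
  have dAA: "2 * a = 2 * b \<longleftrightarrow> a = b \<or> ?R A A a b" for a b :: nat by auto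
  have dAB: "2 * a = g b \<longleftrightarrow> ?R A B a b" if "a \<in> verts A" "b \<in> verts B" for a b
    using D(4)[of True False a b] that by simp
  have dBB: "g a = g b \<longleftrightarrow> a = b \<or> ?R B B a b" if "a \<in> verts B" "b \<in> verts B" for a b
    using D(4)[of False False a b] that by simp
  have eC: "2 * x = h b \<longleftrightarrow> ?R ?AB C x b" if "x \<in> verts ?AB" "b \<in> verts C" for x b
    using E(4)[of True False x b] that by simp
  have eCC: "h a = h b \<longleftrightarrow> a = b \<or> ?R C C a b" if "a \<in> verts C" "b \<in> verts C" for a b
    using E(4)[of False False a b] that by simp
  have nA: "2 * a = labs ?AB ! n \<longleftrightarrow> n < length (labs A) \<and> a = labs A ! n"
    if "a \<in> verts A" "n < length (labs ?AB)" for a n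
  proof (cases "n < length (labs A)")
    case True then show ?thesis using LA by simp
  next
    case False
    then have n: "n < length (labs B)" using that(2) LAB by blast
    then show ?thesis
      using False LB[OF n] dAB[OF that(1) wf_nth_verts[OF B n]] wf_nth_eq[OF B] by auto
  qed
  have nB: "g b = labs ?AB ! n \<longleftrightarrow> n < length (labs B) \<and> b = labs B ! n"
    if "b \<in> verts B" "n < length (labs ?AB)" for b n
  proof (cases "n < length (labs B)")
    case True
    then show ?thesis using LB[OF True] dBB[OF that(1) wf_nth_verts[OF B True]] by auto
  next
    case False
    then have n: "n < length (labs A)" using that(2) LAB by blast
    then show ?thesis
      using False LA[OF n] dAB[OF wf_nth_verts[OF A n] that(1)] wf_nth_eq[OF A] by auto
  qed
  have AC: "2 * (2 * a) = h b \<longleftrightarrow> ?R A C a b" if "a \<in> verts A" "b \<in> verts C" for a b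
    unfolding eC[OF vA[OF that(1)] that(2)] using nA[OF that(1)] LAB by blast
  have BC: "2 * g a = h b \<longleftrightarrow> ?R B C a b" if "a \<in> verts B" "b \<in> verts C" for a b
    unfolding eC[OF vB[OF that(1)] that(2)] using nB[OF that(1)] LAB by blast
  have sym: "?R X Y a b \<longleftrightarrow> ?R Y X b a" for X Y a b by blast
  have I: "{..<3::nat} = {0, 1, 2}" by auto
  let ?f = "\<lambda>i::nat. [?p, ?q, h] ! i"
  have I1: "\<forall>i\<in>{0,1,2::nat}. wf_graph ([A, B, C] ! i)" using A B C by simp
  have I2: "verts (glue ?AB C) = (\<Union>i\<in>{0,1,2::nat}. ?f i ` verts ([A, B, C] ! i))"
    unfolding V by (auto simp: image_image image_Un)
  have I3: "edges (glue ?AB C) = (\<Union>i\<in>{0,1,2::nat}. (`) (?f i) ` edges ([A, B, C] ! i))"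
    unfolding V by (simp add: image_image image_Un Un_assoc)
  have I4: "\<forall>i\<in>{0,1,2::nat}. \<forall>j\<in>{0,1,2::nat}. \<forall>a\<in>verts ([A, B, C] ! i). \<forall>b\<in>verts ([A, B, C] ! j).
     ?f i a = ?f j b \<longleftrightarrow> (i = j \<and> a = b) \<or> ?R ([A, B, C] ! i) ([A, B, C] ! j) a b"
  proof -
    have 2: "?p a = ?q b \<longleftrightarrow> ?R A B a b" "?q b = ?p a \<longleftrightarrow> ?R B A b a"
      if "a \<in> verts A" "b \<in> verts B" for a b
      using dAB[OF that] sym[of A B a b] by (metis mult_cancel1 zero_neq_numeral)+
    have 4: "h b = ?p a \<longleftrightarrow> ?R C A b a" if "a \<in> verts A" "b \<in> verts C" for a b
      using AC[OF that] by metis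
    have 5: "h b = ?q a \<longleftrightarrow> ?R C B b a" if "a \<in> verts B" "b \<in> verts C" for a b
      using BC[OF that] by metis
    have *: "Ball {0,1,2::nat} P \<longleftrightarrow> P 0 \<and> P 1 \<and> P 2" for P by simp
    have n: "[x, y, z] ! 0 = x" "[x, y, z] ! 1 = y" "[x, y, z] ! 2 = z" for x y z :: 'x
      by simp_all
    have ne: "(0::nat) = 1 \<longleftrightarrow> False" "(0::nat) = 2 \<longleftrightarrow> False" "(1::nat) = 0 \<longleftrightarrow> False"
      "(1::nat) = 2 \<longleftrightarrow> False" "(2::nat) = 0 \<longleftrightarrow> False" "(2::nat) = 1 \<longleftrightarrow> False" by simp_all
    show ?thesis
      unfolding * n ne simp_thms
      by (intro conjI ballI; (rule 2 4 5 AC BC; assumption)?)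
        (use dBB eCC in auto)
  qed
  have I5: "\<forall>i\<in>{0,1,2::nat}. \<forall>n<length (labs ([A, B, C] ! i)). n < length (labs (glue ?AB C)) \<and>
      labs (glue ?AB C) ! n = ?f i (labs ([A, B, C] ! i) ! n)"
    using LABC LAB MA MC LA LB by simp
  have I6: "\<forall>n<length (labs (glue ?AB C)). \<exists>i\<in>{0,1,2::nat}. n < length (labs ([A, B, C] ! i))"
    using LABC by simp
  show ?thesis unfolding glued_def I
    by (rule exI[of _ ?f]) (use I1 I2 I3 I4 I5 I6 in blast)
qed

lemma glue_assoc:
  assumes A: "wf_graph A" and B: "wf_graph B" and C: "wf_graph C"
  shows "graph_iso (glue (glue A B) C) (glue A (glue B C))"
proof -
  obtain f where f: "glued {..<3::nat} (\<lambda>i. [A, B, C] ! i) f (glue (glue A B) C)"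
    using glued_glue3[OF A B C] by blast
  obtain g where g: "glued {..<3::nat} (\<lambda>i. [B, C, A] ! i) g (glue (glue B C) A)"
    using glued_glue3[OF B C A] by blast
  let ?\<pi> = "\<lambda>i::nat. [2, 0, 1] ! i"
  have I: "{..<3::nat} = {0, 1, 2}" by auto
  have "bij_betw ?\<pi> {..<3::nat} {..<3::nat}" unfolding I bij_betw_def by (auto simp: inj_on_def)
  note g' = glued_reindex[OF g this]
  have "graph_iso (glue (glue A B) C) (glue (glue B C) A)"
    by (rule glued_unique[OF f g']) (use A B C in \<open>auto simp: I intro: graph_iso_refl\<close>)
  then show ?thesis using graph_iso_trans glue_comm[OF wf_glue[OF B C] A] by blast
qed

lemma wf_empty: "wf_graph (Pregraph {} {} [])"
  by (simp add: wf_graph_def)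

lemma glue_empty:
  assumes "wf_graph A" shows "graph_iso (glue (Pregraph {} {} []) A) A"
proof -
  let ?E = "Pregraph {} {} []"
  have "glued UNIV (\<lambda>i. if i then ?E else A) (\<lambda>i. id) A"
    unfolding glued_def using assms wf_empty by (auto simp: UNIV_bool)
  then show ?thesis
    by (rule glued_unique[OF glued_glue[OF wf_empty assms]])
      (use assms wf_empty in \<open>auto intro: graph_iso_refl\<close>)
qed

lemma hom_count_le:
  assumes "graph_iso A A'" "graph_iso B B'" shows "hom_count A B \<le> hom_count A' B'"
proof -
  obtain p where p: "bij_betw p (verts A') (verts A)" "(`) p ` edges A' = edges A"
    using graph_iso_sym[OF assms(1)] unfolding graph_iso_def by blast
  obtain q where q: "bij_betw q (verts B) (verts B')" "(`) q ` edges B = edges B'"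
    using assms(2) unfolding graph_iso_def by blast
  have wf: "wf_graph A'" "wf_graph B'" using assms by (auto simp: graph_iso_def)
  let ?H = "\<lambda>X Y. {\<phi> \<in> verts X \<rightarrow>\<^sub>E verts Y.
     \<forall>i\<in>verts X. \<forall>j\<in>verts X. {i, j} \<in> edges X \<longrightarrow> {\<phi> i, \<phi> j} \<in> edges Y}"
  let ?T = "\<lambda>\<phi>. restrict (q \<circ> \<phi> \<circ> p) (verts A')"
  have pv: "p i \<in> verts A" if "i \<in> verts A'" for i using p(1) that by (auto simp: bij_betw_def)
  have qv: "q i \<in> verts B'" if "i \<in> verts B" for i using q(1) that by (auto simp: bij_betw_def)
  have "inj_on ?T (?H A B)"
  proof (rule inj_onI)
    fix \<phi> \<psi> assume *: "\<phi> \<in> ?H A B" "\<psi> \<in> ?H A B" "?T \<phi> = ?T \<psi>"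
    have "\<phi> x = \<psi> x" if x: "x \<in> verts A" for x
    proof -
      obtain y where y: "y \<in> verts A'" "x = p y" using p(1) x by (auto simp: bij_betw_def)
      have "q (\<phi> x) = q (\<psi> x)" using fun_cong[OF *(3), of y] y by simp
      moreover have "\<phi> x \<in> verts B" "\<psi> x \<in> verts B" using * x by auto
      ultimately show ?thesis using q(1) by (auto simp: bij_betw_def inj_on_eq_iff)
    qed
    then show "\<phi> = \<psi>" using * by (intro PiE_ext[of \<phi> "verts A" "\<lambda>_. verts B"]) auto
  qed
  moreover have "?T ` ?H A B \<subseteq> ?H A' B'"
  proof (rule image_subsetI)
    fix \<phi> assume \<phi>: "\<phi> \<in> ?H A B"
    have "{q (\<phi> (p i)), q (\<phi> (p j))} \<in> edges B'" if "i \<in> verts A'" "j \<in> verts A'" "{i, j} \<in> edges A'" for i j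
    proof -
      have "p ` {i, j} \<in> edges A" using p(2) that(3) by blast
      then have "{\<phi> (p i), \<phi> (p j)} \<in> edges B" using \<phi> pv that by simp
      then have "q ` {\<phi> (p i), \<phi> (p j)} \<in> edges B'" using q(2) by blast
      then show ?thesis by simp
    qed
    moreover have "q (\<phi> (p i)) \<in> verts B'" if "i \<in> verts A'" for i
    proof (rule qv)
      show "\<phi> (p i) \<in> verts B" using \<phi> pv[OF that] by blast
    qed
    ultimately show "?T \<phi> \<in> ?H A' B'" by auto
  qed
  moreover have "finite (?H A' B')"
    using wf by (intro finite_subset[OF _ finite_PiE[of "verts A'" "\<lambda>_. verts B'"]]) (auto simp: wf_graph_def)
  ultimately show ?thesis unfolding hom_count_def by (rule card_inj_on_le)
qed


section \<open>Isomorphism classes and the monoid algebra\<close>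

text \<open>Every \<^typ>\<open>pregraph\<close> in the domain of \<^const>\<open>graph_iso\<close> is well-formed, so the elements of
  the quotient are the isomorphism classes of labeled finite simple graphs.\<close>

quotient_type lgraph = pregraph / partial: graph_iso
proof (rule part_equivpI)
  show "\<exists>A. graph_iso A A" using graph_iso_refl[OF wf_empty] by blast
  show "symp graph_iso" by (rule sympI) (rule graph_iso_sym)
  show "transp graph_iso" by (rule transpI) (rule graph_iso_trans)
qed

text \<open>The product of graphs is written additively, because \<^typ>\<open>'a \<Rightarrow>\<^sub>0 'b\<close> is the monoid
  algebra of the additive monoid \<^typ>\<open>'a\<close> over \<^typ>\<open>'b\<close>.  Its zero is the empty graph, the
  identity of \<open>\<G>\<^sub>0\<close>; hence \<open>1 :: lgraph \<Rightarrow>\<^sub>0 real\<close> is the identity of \<open>\<A>\<^sub>0\<close>.\<close>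

instantiation lgraph :: comm_monoid_add
begin

lift_definition zero_lgraph :: lgraph is "Pregraph {} {} []"
  by (rule graph_iso_refl[OF wf_empty])

lift_definition plus_lgraph :: "lgraph \<Rightarrow> lgraph \<Rightarrow> lgraph" is glue
  by (rule glue_cong)

instance
proof
  fix F G H :: lgraph
  show "F + G + H = F + (G + H)" by transfer (rule glue_assoc; erule graph_iso_wf)
  show "F + G = G + F" by transfer (rule glue_comm; erule graph_iso_wf)
  show "0 + F = F" by transfer (rule glue_empty; erule graph_iso_wf)
qed

end

lift_definition num_labels :: "lgraph \<Rightarrow> nat" is "\<lambda>A. length (labs A)"
  by (auto simp: graph_iso_def dest: arg_cong[of _ _ length])

lift_definition num_verts :: "lgraph \<Rightarrow> nat" is "\<lambda>A. card (verts A)"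
  by (auto simp: graph_iso_def dest: bij_betw_same_card)

lift_definition all_labeled :: "lgraph \<Rightarrow> bool" is "\<lambda>A. set (labs A) = verts A"
proof -
  have "set (labs B) = verts B" if "graph_iso A B" "set (labs A) = verts A" for A B
    using that unfolding graph_iso_def bij_betw_def by (metis list.set_map)
  then show "(set (labs A) = verts A) = (set (labs B) = verts B)" if "graph_iso A B" for A B
    using that graph_iso_sym by blast
qed

lift_definition unlabel :: "lgraph \<Rightarrow> lgraph" is "\<lambda>A. Pregraph (verts A) (edges A) []"
  by (auto simp: graph_iso_def wf_graph_def)

lift_definition K1 :: lgraph is "Pregraph {0} {} []"
  by (rule graph_iso_refl) (simp add: wf_graph_def)

lift_definition num_homs :: "lgraph \<Rightarrow> lgraph \<Rightarrow> nat" is hom_count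
  using hom_count_le graph_iso_sym by (metis order_antisym)

definition hom_density :: "lgraph \<Rightarrow> lgraph \<Rightarrow> real" where
  "hom_density F G = real (num_homs F G) / real (num_verts G) ^ num_verts F"

definition labeled_graphs :: "nat \<Rightarrow> lgraph set"  ("\<G>") where
  "\<G> k = {G. num_labels G = k}"

lemma num_labels_add: "num_labels (F + G) = max (num_labels F) (num_labels G)"
  by transfer (simp add: glue_def)

lemma labeled_graphs_add: "F \<in> \<G> k \<Longrightarrow> G \<in> \<G> k \<Longrightarrow> F + G \<in> \<G> k"
  by (simp add: labeled_graphs_def num_labels_add)

definition labeled_algebra :: "nat \<Rightarrow> (lgraph \<Rightarrow>\<^sub>0 real) set"  ("\<A>") where
  "\<A> k = {x. Poly_Mapping.keys x \<subseteq> \<G> k}"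

instantiation poly_mapping :: (type, real_vector) real_vector
begin

lift_definition scaleR_poly_mapping :: "real \<Rightarrow> ('a \<Rightarrow>\<^sub>0 'b) \<Rightarrow> 'a \<Rightarrow>\<^sub>0 'b" is
  "\<lambda>r f x. r *\<^sub>R f x"
  by (rule finite_subset) auto

instance
  by standard (transfer; simp add: fun_eq_iff scaleR_add_left scaleR_add_right)+

end

definition fully_labeled_algebra :: "nat \<Rightarrow> (lgraph \<Rightarrow>\<^sub>0 real) set"  ("\<A>\<^sup>0") where
  "\<A>\<^sup>0 k = span {Poly_Mapping.single G 1 |G. G \<in> \<G> k \<and> all_labeled G}"

text \<open>Since \<open>\<A> k\<close> is closed under the product of \<^typ>\<open>lgraph \<Rightarrow>\<^sub>0 real\<close>, the squares below are those
  of the algebra \<open>\<A> k\<close>, although its identity is not \<open>1\<close> unless \<open>k = 0\<close>.\<close>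

definition sums_of_squares :: "'a::comm_semiring_1 set \<Rightarrow> 'a set"  ("\<Sigma>\<^sup>2") where
  "\<Sigma>\<^sup>2 S = {\<Sum>x\<leftarrow>xs. x\<^sup>2 |xs. set xs \<subseteq> S}"

definition unlabel_linear :: "(lgraph \<Rightarrow>\<^sub>0 real) \<Rightarrow> (lgraph \<Rightarrow>\<^sub>0 real)" where
  "unlabel_linear x =
     (\<Sum>G\<in>Poly_Mapping.keys x. Poly_Mapping.single (unlabel G) (Poly_Mapping.lookup x G))"

text \<open>For unlabeled graphs the product \<open>G + K1\<close> is the disjoint union.\<close>

definition coincide :: "(lgraph \<Rightarrow>\<^sub>0 real) \<Rightarrow> (lgraph \<Rightarrow>\<^sub>0 real) \<Rightarrow> bool" where
  "coincide x y \<longleftrightarrow> unlabel_linear x - unlabel_linear y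
     \<in> span {Poly_Mapping.single (G + K1) 1 - Poly_Mapping.single G 1 |G. G \<in> \<G> 0}"

text \<open>The density into the graph without vertices is the undefined quotient \<open>0 / 0\<close> (except for that
  of the empty graph), so target graphs are required to have a vertex.\<close>

definition nonneg_quantum_graph :: "(lgraph \<Rightarrow>\<^sub>0 real) \<Rightarrow> bool" where
  "nonneg_quantum_graph a \<longleftrightarrow> (\<forall>G\<in>\<G> 0. num_verts G \<noteq> 0 \<longrightarrow>
     (\<Sum>F\<in>Poly_Mapping.keys a. Poly_Mapping.lookup a F * hom_density F G) \<ge> 0)"

end

theory Submission
  imports Defs
begin

text \<open>
  Densities are averages of evaluations.  A graph \<open>S\<close> on the labeled vertices \<open>{..<k}\<close> is
  evaluated at a graph \<open>T\<close> and a map \<open>\<phi>\<close> of \<open>{..<k}\<close> into its vertices as the indicator of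
  \<open>\<phi>(S) \<subseteq> T\<close>.  This is multiplicative under gluing, and its average over all \<open>\<phi>\<close> is the density of
  the unlabeled graph.  Hence the density of a square \<open>x\<^sup>2\<close> of a fully labeled element is an average
  of squares of real numbers (\<open>square_density_nonneg\<close>).  Densities do not see isolated vertices
  (\<open>coincide_density\<close>), so a quantum graph for which every \<open>a + \<epsilon>\<close> coincides with a sum of
  squares satisfies \<open>t(a, G) \<ge> -\<epsilon>\<close> for all \<open>\<epsilon> > 0\<close>.

  For the converse, \<open>\<A>\<^sup>0 k\<close> is viewed as the algebra of real functions on the finite set of all
  graphs \<open>H\<close> on \<open>{..<k}\<close>, where the labeled graph \<open>F\<close> is the indicator of \<open>F \<subseteq> H\<close>.  The indicators
  of single points are idempotent elements of the algebra, so a function with values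
  \<open>f(H) \<ge> 0\<close> is the sum of the squares of \<open>sqrt(f(H))\<close> times these idempotents
  (\<open>nonneg_on_cube_imp_sum_of_squares\<close>).  It remains to lift \<open>a + \<epsilon>\<close> to such a function.
  Replacing every graph \<open>F\<close> in \<open>a + \<epsilon>\<close> by the average of its images under all injections of its
  vertices into \<open>{..<k}\<close> changes it only by labels and isolated vertices, and the value of the
  result at \<open>H\<close> is the combination of the injective densities \<open>t\<^sub>i\<^sub>n\<^sub>j(F, H)\<close>.  For maps of \<open>n\<close>
  vertices, these differ from \<open>t(F, H)\<close> by at most the proportion of noninjective maps
  (\<open>injective_density_approx\<close>), which tends to \<open>0\<close> as \<open>k\<close> grows.  Since \<open>t(a + \<epsilon>, H) \<ge> \<epsilon>\<close>, all
  values are nonnegative once \<open>k\<close> is large.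
\<close>

section \<open>Linear extension of maps on a basis\<close>

definition linear_extension :: "('a \<Rightarrow> 'v) \<Rightarrow> ('a \<Rightarrow>\<^sub>0 real) \<Rightarrow> 'v::real_vector" where
  "linear_extension g x = (\<Sum>G\<in>Poly_Mapping.keys x. Poly_Mapping.lookup x G *\<^sub>R g G)"

lemma linear_extension_superset:
  assumes "finite K" "Poly_Mapping.keys x \<subseteq> K"
  shows "linear_extension g x = (\<Sum>G\<in>K. Poly_Mapping.lookup x G *\<^sub>R g G)"
  unfolding linear_extension_def using assms
  by (intro sum.mono_neutral_left) (auto simp: in_keys_iff)

lemma lookup_scaleR: "Poly_Mapping.lookup (r *\<^sub>R x) G = r *\<^sub>R Poly_Mapping.lookup x G"
  by (simp add: scaleR_poly_mapping.rep_eq)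

lemma linear_linear_extension: "linear (linear_extension g)"
proof (rule linearI)
  fix x y :: "'a \<Rightarrow>\<^sub>0 real" and r :: real
  let ?K = "Poly_Mapping.keys x \<union> Poly_Mapping.keys y"
  have "linear_extension g (x + y) = (\<Sum>G\<in>?K. Poly_Mapping.lookup (x + y) G *\<^sub>R g G)"
    by (rule linear_extension_superset) (use keys_add[of x y] in auto)
  also have "\<dots> = linear_extension g x + linear_extension g y"
    by (simp add: linear_extension_superset[of ?K] lookup_add scaleR_add_left sum.distrib)
  finally show "linear_extension g (x + y) = linear_extension g x + linear_extension g y" .
  have "linear_extension g (r *\<^sub>R x) = (\<Sum>G\<in>Poly_Mapping.keys x. Poly_Mapping.lookup (r *\<^sub>R x) G *\<^sub>R g G)"
    by (rule linear_extension_superset) (auto simp: in_keys_iff lookup_scaleR)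
  then show "linear_extension g (r *\<^sub>R x) = r *\<^sub>R linear_extension g x"
    by (simp add: linear_extension_def lookup_scaleR scaleR_sum_right)
qed

lemma linear_extension_single [simp]: "linear_extension g (Poly_Mapping.single G c) = c *\<^sub>R g G"
  by (simp add: linear_extension_def)

lemma scaleR_conv_mult:
  fixes x :: "'a::comm_monoid_add \<Rightarrow>\<^sub>0 real"
  shows "r *\<^sub>R x = Poly_Mapping.single 0 r * x"
proof -
  have "r *\<^sub>R x = Poly_Mapping.map ((*) r) x"
    by (rule poly_mapping_eqI) (simp add: lookup_scaleR map.rep_eq when_def)
  then show ?thesis by (simp add: mult_map_scale_conv_mult)
qed

lemma scaleR_mult_poly_mapping:
  fixes x y :: "'a::comm_monoid_add \<Rightarrow>\<^sub>0 real"
  shows "(r *\<^sub>R x) * y = r *\<^sub>R (x * y)" "x * (r *\<^sub>R y) = r *\<^sub>R (x * y)"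
  by (simp_all add: scaleR_conv_mult ac_simps)

lemma scaleR_single: "r *\<^sub>R Poly_Mapping.single G (c::real) = Poly_Mapping.single G (r * c)"
  by (rule poly_mapping_eqI) (simp add: lookup_scaleR lookup_single when_def)

lemma poly_mapping_conv_sum:
  fixes x :: "'a \<Rightarrow>\<^sub>0 real"
  shows "x = (\<Sum>G\<in>Poly_Mapping.keys x. Poly_Mapping.lookup x G *\<^sub>R Poly_Mapping.single G 1)"
  by (rule poly_mapping_eqI) (auto simp: lookup_sum scaleR_single lookup_single when_def in_keys_iff sum.delta' if_distrib cong: if_cong)

lemma in_span_image_finite:
  fixes g :: "'i \<Rightarrow> 'v::real_vector"
  assumes "finite A" "x \<in> span (g ` A)"
  obtains c where "x = (\<Sum>i\<in>A. c i *\<^sub>R g i)"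
proof -
  obtain A' where A': "A' \<subseteq> A" "inj_on g A'" "g ` A = g ` A'"
    using subset_image_inj[of "g ` A" g A] by auto
  have "finite (g ` A')" "x \<in> span (g ` A')" using assms A'(3) by (metis finite_imageI)+
  then obtain u where "x = (\<Sum>v\<in>g ` A'. u v *\<^sub>R v)" by (auto simp: span_finite)
  also have "\<dots> = (\<Sum>i\<in>A'. u (g i) *\<^sub>R g i)" by (simp add: sum.reindex[OF A'(2)])
  also have "\<dots> = (\<Sum>i\<in>A. (if i \<in> A' then u (g i) else 0) *\<^sub>R g i)"
    using assms(1) A'(1) by (intro sum.mono_neutral_cong_left) auto
  finally show ?thesis by (rule that)
qed

section \<open>Graphs on an initial segment\<close>

text \<open>Every isomorphism class of unlabeled or fully labeled graphs has a representative whose vertex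
  set is \<open>{..<k}\<close>, with the vertex \<open>i\<close> carrying the label \<open>i\<close> in the labeled case.  Products and
  densities are computed with these representatives, which turns them into statements about edge
  sets.\<close>

definition pairs :: "nat \<Rightarrow> nat set set" where
  "pairs k = {e. e \<subseteq> {..<k} \<and> card e = 2}"

lemma finite_pairs [simp]: "finite (pairs k)"
  by (rule finite_subset[of _ "Pow {..<k}"]) (auto simp: pairs_def)

lemma pairs_mono: "m \<le> n \<Longrightarrow> pairs m \<subseteq> pairs n"
  by (fastforce simp: pairs_def)

text \<open>The intersection with \<^term>\<open>pairs k\<close> makes these functions total: any set \<open>S\<close> gives a
  well-formed graph.\<close>

lift_definition labeled_on :: "nat \<Rightarrow> nat set set \<Rightarrow> lgraph" is
  "\<lambda>k S. Pregraph {..<k} (S \<inter> pairs k) [0..<k]"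
  by (rule graph_iso_refl) (auto simp: wf_graph_def pairs_def)

lift_definition unlabeled_on :: "nat \<Rightarrow> nat set set \<Rightarrow> lgraph" is
  "\<lambda>k S. Pregraph {..<k} (S \<inter> pairs k) []"
  by (rule graph_iso_refl) (auto simp: wf_graph_def pairs_def)

lemma unlabel_labeled_on [simp]: "unlabel (labeled_on k S) = unlabeled_on k S"
  by transfer (auto intro!: graph_iso_refl simp: wf_graph_def pairs_def)

lemma num_labels_labeled_on [simp]: "num_labels (labeled_on k S) = k"
  by transfer simp

lemma all_labeled_labeled_on [simp]: "all_labeled (labeled_on k S)"
  by transfer auto

lemma num_labels_unlabeled_on [simp]: "num_labels (unlabeled_on k S) = 0"
  by transfer simp

lemma num_verts_unlabeled_on [simp]: "num_verts (unlabeled_on k S) = k"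
  by transfer simp

lemma labeled_on_add: "labeled_on k S + labeled_on k T = labeled_on k (S \<union> T)"
proof transfer
  fix k S T
  let ?P = "\<lambda>S. Pregraph {..<k} (S \<inter> pairs k) [0..<k]"
  have wf: "wf_graph (?P S)" for S by (auto simp: wf_graph_def pairs_def)
  have "glued UNIV (\<lambda>i. if i then ?P S else ?P T) (\<lambda>i. id) (?P (S \<union> T))"
    unfolding glued_def using wf by (auto simp: UNIV_bool)
  then show "graph_iso (glue (?P S) (?P T)) (?P (S \<union> T))"
    by (rule glued_unique[OF glued_glue[OF wf wf]]) (auto intro: graph_iso_refl wf)
qed

lemma unlabeled_on_add_K1:
  assumes "S \<subseteq> pairs n"
  shows "unlabeled_on n S + K1 = unlabeled_on (Suc n) S"
  using assms
proof transfer
  fix S n assume S: "S \<subseteq> pairs n"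
  let ?P = "\<lambda>n. Pregraph {..<n} (S \<inter> pairs n) []"
  have wf: "wf_graph (?P n)" for n by (auto simp: wf_graph_def pairs_def)
  have wf1: "wf_graph (Pregraph {0} {} [])" by (auto simp: wf_graph_def)
  have eq: "S \<inter> pairs (Suc n) = S" "S \<inter> pairs n = S"
    using S pairs_mono[of n "Suc n"] by auto
  have "glued UNIV (\<lambda>i. if i then ?P n else Pregraph {0} {} []) (\<lambda>i. if i then id else (\<lambda>_. n)) (?P (Suc n))"
    unfolding glued_def using wf[of n] wf1 by (auto simp: UNIV_bool eq)
  then show "graph_iso (glue (?P n) (Pregraph {0} {} [])) (?P (Suc n))"
    by (rule glued_unique[OF glued_glue[OF wf wf1]]) (auto intro: graph_iso_refl wf wf1)
qed

lemma relabeled_edges_subset_pairs: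
  assumes wf: "wf_graph A" and f: "bij_betw f (verts A) {..<n}"
  shows "(`) f ` edges A \<subseteq> pairs n"
proof (rule image_subsetI)
  fix e assume "e \<in> edges A"
  then have e: "e \<subseteq> verts A" "card e = 2" using wf by (auto simp: wf_graph_def)
  have "inj_on f e" using f e inj_on_subset by (auto simp: bij_betw_def)
  then show "f ` e \<in> pairs n"
    using e f by (auto simp: pairs_def card_image bij_betw_def)
qed

lemma unlabeled_on_exhaust:
  assumes "num_labels G = 0"
  shows "\<exists>S\<subseteq>pairs (num_verts G). G = unlabeled_on (num_verts G) S"
  using assms
proof transfer
  fix A assume "graph_iso A A" and len: "length (labs A) = 0"
  then have wf: "wf_graph A" by (blast intro: graph_iso_wf)
  then obtain f where f: "bij_betw f (verts A) {..<card (verts A)}"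
    using ex_bij_betw_finite_nat[of "verts A"] by (auto simp: wf_graph_def atLeast0LessThan)
  let ?S = "(`) f ` edges A"
  have S: "?S \<subseteq> pairs (card (verts A))" by (rule relabeled_edges_subset_pairs[OF wf f])
  have "graph_iso A (Pregraph {..<card (verts A)} (?S \<inter> pairs (card (verts A))) [])"
    unfolding graph_iso_def using wf f S len
    by (auto intro!: exI[of _ f] simp: Int_absorb2 wf_graph_def pairs_def)
  then show "\<exists>S\<subseteq>pairs (card (verts A)). graph_iso A (Pregraph {..<card (verts A)} (S \<inter> pairs (card (verts A))) [])"
    using S by blast
qed

lemma labeled_on_exhaust:
  assumes "num_labels G = k" "all_labeled G"
  shows "\<exists>S\<subseteq>pairs k. G = labeled_on k S"
  using assms
proof transfer
  fix A k assume "graph_iso A A" and len: "length (labs A) = k" and lab: "set (labs A) = verts A"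
  then have wf: "wf_graph A" by (blast intro: graph_iso_wf)
  have "bij_betw ((!) (labs A)) {..<k} (verts A)"
    using wf len lab by (auto intro!: bij_betw_nth simp: wf_graph_def)
  then obtain f where f: "bij_betw f (verts A) {..<k}" and fl: "\<And>i. i < k \<Longrightarrow> f (labs A ! i) = i"
    using bij_betw_inv_into[of "(!) (labs A)" "{..<k}" "verts A"] bij_betw_inv_into_left
    by (metis lessThan_iff)
  let ?S = "(`) f ` edges A"
  have S: "?S \<subseteq> pairs k" by (rule relabeled_edges_subset_pairs[OF wf f])
  have m: "map f (labs A) = [0..<k]" using len fl by (auto intro: nth_equalityI)
  have "graph_iso A (Pregraph {..<k} (?S \<inter> pairs k) [0..<k])"
    unfolding graph_iso_def using wf f S m
    by (auto intro!: exI[of _ f] simp: Int_absorb2 wf_graph_def pairs_def)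
  then show "\<exists>S\<subseteq>pairs k. graph_iso A (Pregraph {..<k} (S \<inter> pairs k) [0..<k])"
    using S by blast
qed

lemma unlabeled_on_eqI:
  assumes "graph_iso (Pregraph {..<k} (S \<inter> pairs k) []) (Pregraph {..<l} (T \<inter> pairs l) [])"
  shows "unlabeled_on k S = unlabeled_on l T"
  using assms by transfer

text \<open>The injection extends to a permutation of \<open>{..<k}\<close>, which is an isomorphism between the two
  graphs.\<close>

lemma unlabeled_on_inj_image:
  assumes p: "inj_on p {..<n}" "p ` {..<n} \<subseteq> {..<k}" and S: "S \<subseteq> pairs n"
  shows "unlabeled_on k ((`) p ` S) = unlabeled_on k S"
proof -
  have nk: "n \<le> k" using card_inj_on_le[OF p] by simp
  have "card ({..<k} - {..<n}) = card ({..<k} - p ` {..<n})"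
    using nk p by (simp add: card_Diff_subset card_image)
  then obtain q where q: "bij_betw q ({..<k} - {..<n}) ({..<k} - p ` {..<n})"
    using finite_same_card_bij[of "{..<k} - {..<n}" "{..<k} - p ` {..<n}"] by auto
  define r where "r i = (if i \<in> {..<n} then p i else q i)" for i
  have "bij_betw r ({..<n} \<union> ({..<k} - {..<n})) (p ` {..<n} \<union> ({..<k} - p ` {..<n}))"
    unfolding r_def using p(1) q
    by (intro bij_betw_disjoint_Un) (auto simp: bij_betw_def)
  then have r: "bij_betw r {..<k} {..<k}"
    using nk p(2) by (simp add: Un_absorb1 ivl_disj_un)
  have "r ` e = p ` e" if "e \<in> S" for e
    by (rule image_cong[OF refl]) (use that S in \<open>auto simp: r_def pairs_def\<close>)
  then have rS: "(`) r ` S = (`) p ` S" by (rule image_cong[OF refl])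
  have Sk: "S \<subseteq> pairs k" using S pairs_mono[OF nk] by blast
  have wf: "wf_graph (Pregraph {..<k} (T \<inter> pairs k) [])" for T by (auto simp: wf_graph_def pairs_def)
  have "(`) r ` S \<subseteq> pairs k"
    using relabeled_edges_subset_pairs[OF wf[of S]] r Sk by (simp add: Int_absorb2)
  then have "(`) r ` (S \<inter> pairs k) = (`) p ` S \<inter> pairs k" using rS Sk by (simp add: Int_absorb2)
  then have "graph_iso (Pregraph {..<k} (S \<inter> pairs k) []) (Pregraph {..<k} ((`) p ` S \<inter> pairs k) [])"
    unfolding graph_iso_def using wf r by auto
  then show ?thesis
    by (rule unlabeled_on_eqI[symmetric])
qed


section \<open>Homomorphism densities\<close>

definition edge_maps :: "nat \<Rightarrow> nat set set \<Rightarrow> nat \<Rightarrow> nat set set \<Rightarrow> (nat \<Rightarrow> nat) set" where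
  "edge_maps n S m T = {\<phi> \<in> {..<n} \<rightarrow>\<^sub>E {..<m}. (`) \<phi> ` S \<subseteq> T}"

lemma finite_edge_maps [simp]: "finite (edge_maps n S m T)"
  unfolding edge_maps_def by (rule finite_subset[OF _ finite_PiE[of "{..<n}" "\<lambda>_. {..<m}"]]) auto

lemma num_homs_unlabeled_on:
  assumes "S \<subseteq> pairs n" "T \<subseteq> pairs m"
  shows "num_homs (unlabeled_on n S) (unlabeled_on m T) = card (edge_maps n S m T)"
  using assms
proof transfer
  fix S n T m assume S: "S \<subseteq> pairs n" and T: "T \<subseteq> pairs m"
  have "(\<forall>i\<in>{..<n}. \<forall>j\<in>{..<n}. {i, j} \<in> S \<longrightarrow> {\<phi> i, \<phi> j} \<in> T) \<longleftrightarrow> (`) \<phi> ` S \<subseteq> T" for \<phi>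
  proof
    assume *: "\<forall>i\<in>{..<n}. \<forall>j\<in>{..<n}. {i, j} \<in> S \<longrightarrow> {\<phi> i, \<phi> j} \<in> T"
    show "(`) \<phi> ` S \<subseteq> T"
    proof (rule image_subsetI)
      fix e assume e: "e \<in> S"
      then have "e \<subseteq> {..<n}" "card e = 2" using S by (auto simp: pairs_def)
      then obtain i j where "e = {i, j}" "i \<in> {..<n}" "j \<in> {..<n}" by (auto simp: card_2_iff)
      then show "\<phi> ` e \<in> T" using * e by auto
    qed
  next
    assume *: "(`) \<phi> ` S \<subseteq> T"
    have "{\<phi> i, \<phi> j} \<in> T" if "{i, j} \<in> S" for i j
      using subsetD[OF * imageI[OF that]] by simp
    then show "\<forall>i\<in>{..<n}. \<forall>j\<in>{..<n}. {i, j} \<in> S \<longrightarrow> {\<phi> i, \<phi> j} \<in> T" by blast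
  qed
  then show "hom_count (Pregraph {..<n} (S \<inter> pairs n) []) (Pregraph {..<m} (T \<inter> pairs m) [])
      = card (edge_maps n S m T)"
    using S T by (simp add: hom_count_def edge_maps_def Int_absorb2)
qed

lemma hom_density_unlabeled_on:
  assumes "S \<subseteq> pairs n" "T \<subseteq> pairs m"
  shows "hom_density (unlabeled_on n S) (unlabeled_on m T) = card (edge_maps n S m T) / real m ^ n"
  by (simp add: hom_density_def num_homs_unlabeled_on[OF assms])

lemma card_edge_maps_Suc:
  assumes S: "S \<subseteq> pairs n"
  shows "card (edge_maps (Suc n) S m T) = m * card (edge_maps n S m T)"
proof -
  let ?f = "\<lambda>(y, \<phi>). \<phi>(n := y)"
  have img: "(\<phi>(n := y)) ` e = \<phi> ` e" if "e \<in> S" for e \<phi> and y :: nat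
    by (rule image_cong[OF refl]) (use that S in \<open>auto simp: pairs_def\<close>)
  have img': "(`) (\<phi>(n := y)) ` S = (`) \<phi> ` S" for \<phi> and y :: nat
    by (rule image_cong[OF refl img])
  have "edge_maps (Suc n) S m T = ?f ` ({..<m} \<times> edge_maps n S m T)"
  proof (intro equalityI subsetI)
    fix \<psi> assume \<psi>: "\<psi> \<in> edge_maps (Suc n) S m T"
    then obtain y \<phi> where *: "\<psi> = \<phi>(n := y)" "y \<in> {..<m}" "\<phi> \<in> {..<n} \<rightarrow>\<^sub>E {..<m}"
      unfolding edge_maps_def lessThan_Suc PiE_insert_eq by auto
    then have "\<phi> \<in> edge_maps n S m T" using \<psi> img'[of \<phi> y] by (simp add: edge_maps_def)
    then show "\<psi> \<in> ?f ` ({..<m} \<times> edge_maps n S m T)" using * by force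
  next
    fix \<psi> assume "\<psi> \<in> ?f ` ({..<m} \<times> edge_maps n S m T)"
    then obtain y \<phi> where *: "\<psi> = \<phi>(n := y)" "y \<in> {..<m}" "\<phi> \<in> edge_maps n S m T" by auto
    then have "\<psi> \<in> insert n {..<n} \<rightarrow>\<^sub>E {..<m}"
      unfolding PiE_insert_eq by (auto simp: edge_maps_def intro!: image_eqI[of _ _ "(y, \<phi>)"])
    then show "\<psi> \<in> edge_maps (Suc n) S m T"
      using * img'[of \<phi> y] by (simp add: edge_maps_def lessThan_Suc)
  qed
  moreover have "inj_on ?f ({..<m} \<times> edge_maps n S m T)"
    by (rule inj_on_subset[OF inj_combinator[of n "{..<n}" "\<lambda>_. {..<m}"]]) (auto simp: edge_maps_def)
  ultimately show ?thesis by (simp add: card_image card_cartesian_product)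
qed

lemma hom_density_add_K1:
  assumes F: "num_labels F = 0" and G: "num_labels G = 0" "num_verts G \<noteq> 0"
  shows "hom_density (F + K1) G = hom_density F G"
proof -
  obtain n S where S: "S \<subseteq> pairs n" "F = unlabeled_on n S"
    using unlabeled_on_exhaust[OF F] by blast
  obtain m T where T: "T \<subseteq> pairs m" "G = unlabeled_on m T"
    using unlabeled_on_exhaust[OF G(1)] by blast
  have S': "S \<subseteq> pairs (Suc n)" using S(1) pairs_mono[of n "Suc n"] by auto
  show ?thesis
    using G(2) unfolding S(2) T(2) unlabeled_on_add_K1[OF S(1)]
    by (simp add: hom_density_unlabeled_on[OF S' T(1)] hom_density_unlabeled_on[OF S(1) T(1)]
        card_edge_maps_Suc[OF S(1)])
qed

section \<open>Forgetting labels and isolated vertices\<close>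

lemma unlabel_linear_conv: "unlabel_linear = linear_extension (\<lambda>G. Poly_Mapping.single (unlabel G) 1)"
  by (simp add: fun_eq_iff unlabel_linear_def linear_extension_def scaleR_single)

lemma linear_unlabel_linear: "linear unlabel_linear"
  unfolding unlabel_linear_conv by (rule linear_linear_extension)

lemma unlabel_unlabeled: "num_labels G = 0 \<Longrightarrow> unlabel G = G"
proof transfer
  fix A assume "graph_iso A A" "length (labs A) = 0"
  moreover have "Pregraph (verts A) (edges A) [] = A" if "labs A = []" using that by (cases A) auto
  ultimately show "graph_iso (Pregraph (verts A) (edges A) []) A" by simp
qed

lemma unlabel_linear_unlabeled:
  assumes "x \<in> \<A> 0" shows "unlabel_linear x = x"
proof -
  have "unlabel_linear x = (\<Sum>G\<in>Poly_Mapping.keys x. Poly_Mapping.lookup x G *\<^sub>R Poly_Mapping.single G 1)"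
    unfolding unlabel_linear_conv linear_extension_def
    using assms by (intro sum.cong) (auto simp: labeled_algebra_def labeled_graphs_def unlabel_unlabeled)
  then show ?thesis using poly_mapping_conv_sum[of x] by simp
qed

text \<open>The density into a fixed graph is a linear functional that vanishes on the generators
  \<open>G \<squnion> K\<^sub>1 - G\<close>.\<close>

lemma coincide_density:
  assumes "coincide x y" "num_labels G = 0" "num_verts G \<noteq> 0"
  defines "t \<equiv> linear_extension (\<lambda>F. hom_density F G)"
  shows "t (unlabel_linear x) = t (unlabel_linear y)"
proof -
  have lin: "linear t" unfolding t_def by (rule linear_linear_extension)
  have "t (unlabel_linear x - unlabel_linear y) = 0"
  proof (rule linear_eq_0_on_span[OF lin])
    show "unlabel_linear x - unlabel_linear y
        \<in> span {Poly_Mapping.single (F + K1) 1 - Poly_Mapping.single F 1 |F. F \<in> \<G> 0}"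
      using assms(1) by (simp add: coincide_def)
    fix z :: "lgraph \<Rightarrow>\<^sub>0 real"
    assume "z \<in> {Poly_Mapping.single (F + K1) 1 - Poly_Mapping.single F 1 |F. F \<in> \<G> 0}"
    then obtain F where F: "num_labels F = 0"
      "z = Poly_Mapping.single (F + K1) 1 - Poly_Mapping.single F 1"
      by (auto simp: labeled_graphs_def)
    have single: "t (Poly_Mapping.single F 1) = hom_density F G" for F by (simp add: t_def)
    show "t z = 0"
      unfolding F(2) linear_diff[OF lin] single by (simp add: hom_density_add_K1 F(1) assms(2,3))
  qed
  then show ?thesis by (simp add: linear_diff[OF lin])
qed

section \<open>Fully labeled graphs\<close>

abbreviation fully_labeled :: "nat \<Rightarrow> nat set set \<Rightarrow> lgraph \<Rightarrow>\<^sub>0 real" where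
  "fully_labeled k S \<equiv> Poly_Mapping.single (labeled_on k S) 1"

lemma fully_labeled_mult: "fully_labeled k S * fully_labeled k T = fully_labeled k (S \<union> T)"
  by (simp add: mult_single labeled_on_add)

lemma fully_labeled_algebra_conv: "\<A>\<^sup>0 k = span (fully_labeled k ` Pow (pairs k))"
proof -
  have "{Poly_Mapping.single G 1 |G. G \<in> \<G> k \<and> all_labeled G} = fully_labeled k ` Pow (pairs k)"
    using labeled_on_exhaust by (fastforce simp: labeled_graphs_def)
  then show ?thesis by (simp add: fully_labeled_algebra_def)
qed

text \<open>Write \<open>i \<phi> S\<close> for the indicator of \<open>\<phi>(S) \<subseteq> T\<close>.  It is multiplicative,
  \<open>i \<phi> (S \<union> S') = i \<phi> S * i \<phi> S'\<close>, so for \<open>x = \<Sum>\<^sub>S c\<^sub>S S\<close> the density of \<open>x\<^sup>2\<close> is the average of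
  \<open>(\<Sum>\<^sub>S c\<^sub>S i \<phi> S)\<^sup>2\<close> over all maps \<open>\<phi>\<close>, injective or not.\<close>

lemma square_density_nonneg:
  assumes x: "x \<in> \<A>\<^sup>0 k" and G: "num_labels G = 0"
  shows "linear_extension (\<lambda>F. hom_density F G) (unlabel_linear (x\<^sup>2)) \<ge> 0"
proof -
  define m where "m = num_verts G"
  obtain T where T: "T \<subseteq> pairs m" "G = unlabeled_on m T"
    using unlabeled_on_exhaust[OF G] unfolding m_def by blast
  define \<Phi> where "\<Phi> = {..<k} \<rightarrow>\<^sub>E {..<m}"
  define i where "i \<phi> S = (if (`) \<phi> ` S \<subseteq> T then 1 else 0 :: real)" for \<phi> :: "nat \<Rightarrow> nat" and S
  define t where "t = linear_extension (\<lambda>F. hom_density F G) \<circ> unlabel_linear"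
  have fin: "finite \<Phi>" unfolding \<Phi>_def by (intro finite_PiE) auto
  have lin: "linear t"
    unfolding t_def by (intro linear_compose linear_unlabel_linear linear_linear_extension)
  have t: "t (fully_labeled k S) = (\<Sum>\<phi>\<in>\<Phi>. i \<phi> S) / real m ^ k" if "S \<subseteq> pairs k" for S
  proof -
    have "real (card (edge_maps k S m T)) = (\<Sum>\<phi>\<in>\<Phi>. i \<phi> S)"
      unfolding edge_maps_def i_def \<Phi>_def[symmetric] using fin by (simp add: sum.If_cases Int_def)
    then show ?thesis
      by (simp add: t_def unlabel_linear_conv T(2) hom_density_unlabeled_on[OF that T(1)])
  qed
  have i_mult: "i \<phi> (S \<union> S') = i \<phi> S * i \<phi> S'" for \<phi> S S' by (auto simp: i_def)
  obtain c where c: "x = (\<Sum>S\<in>Pow (pairs k). c S *\<^sub>R fully_labeled k S)"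
    using x in_span_image_finite[of "Pow (pairs k)" x "fully_labeled k"]
    by (auto simp: fully_labeled_algebra_conv)
  have "x\<^sup>2 = (\<Sum>S\<in>Pow (pairs k). \<Sum>S'\<in>Pow (pairs k). (c S * c S') *\<^sub>R fully_labeled k (S \<union> S'))"
    unfolding c power2_eq_square sum_product scaleR_mult_poly_mapping fully_labeled_mult
    by (simp add: mult.commute)
  then have "t (x\<^sup>2) = (\<Sum>S\<in>Pow (pairs k). \<Sum>S'\<in>Pow (pairs k). (c S * c S') * t (fully_labeled k (S \<union> S')))"
    by (simp add: linear_sum[OF lin] linear_scale[OF lin])
  also have "\<dots> = (\<Sum>S\<in>Pow (pairs k). \<Sum>S'\<in>Pow (pairs k).
      (c S * c S') * ((\<Sum>\<phi>\<in>\<Phi>. i \<phi> S * i \<phi> S') / real m ^ k))"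
    by (intro sum.cong refl) (simp add: t i_mult)
  also have "\<dots> = (\<Sum>S\<in>Pow (pairs k). \<Sum>S'\<in>Pow (pairs k). \<Sum>\<phi>\<in>\<Phi>.
      (c S * i \<phi> S) * (c S' * i \<phi> S')) / real m ^ k"
    by (simp add: sum_divide_distrib sum_distrib_left ac_simps)
  also have "\<dots> = (\<Sum>\<phi>\<in>\<Phi>. \<Sum>S\<in>Pow (pairs k). \<Sum>S'\<in>Pow (pairs k).
      (c S * i \<phi> S) * (c S' * i \<phi> S')) / real m ^ k"
    by (subst sum.swap[of _ \<Phi>], subst sum.swap[of _ \<Phi>]) (rule refl)
  also have "\<dots> = (\<Sum>\<phi>\<in>\<Phi>. (\<Sum>S\<in>Pow (pairs k). c S * i \<phi> S)\<^sup>2) / real m ^ k"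
    by (simp add: power2_eq_square sum_product)
  also have "\<dots> \<ge> 0" by (intro divide_nonneg_nonneg sum_nonneg) auto
  finally show ?thesis by (simp add: t_def)
qed

section \<open>Nonnegative functions on the cube\<close>

text \<open>Idempotents \<open>z e\<close> behave like the coordinate functions on the cube of subsets \<open>H\<close> of \<open>E\<close>, and
  \<open>\<delta> H\<close> like the indicator of the point \<open>H\<close>: the partition of unity comes from expanding
  \<open>\<Prod>\<^sub>e (z e + (1 - z e)) = 1\<close>, and a monomial \<open>\<Prod>\<^sub>e\<^sub>\<in>\<^sub>F z e\<close> is the indicator of \<open>F \<subseteq> H\<close> because
  \<open>z e (1 - z e) = 0\<close>.\<close>

lemma idempotent_atoms:
  fixes z :: "'e \<Rightarrow> 'r::comm_ring_1"
  assumes E: "finite E" and z: "\<And>e. e \<in> E \<Longrightarrow> z e * z e = z e"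
  defines "\<delta> \<equiv> \<lambda>H. prod z H * (\<Prod>e\<in>E - H. 1 - z e)"
  shows "(\<Sum>H\<in>Pow E. \<delta> H) = 1"
    and "H \<subseteq> E \<Longrightarrow> \<delta> H * \<delta> H = \<delta> H"
    and "H \<subseteq> E \<Longrightarrow> F \<subseteq> E \<Longrightarrow> prod z F * \<delta> H = (if F \<subseteq> H then \<delta> H else 0)"
proof -
  have "(\<Sum>H\<in>Pow E. \<delta> H) = (\<Prod>e\<in>E. z e + (1 - z e))"
    unfolding \<delta>_def by (rule prod_add[OF E, symmetric])
  then show "(\<Sum>H\<in>Pow E. \<delta> H) = 1" by simp
  have P: "prod z A * prod z A = prod z A" if "A \<subseteq> E" for A
    using that z unfolding prod.distrib[symmetric] by (auto intro!: prod.cong)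
  have Q: "(\<Prod>e\<in>A. 1 - z e) * (\<Prod>e\<in>A. 1 - z e) = (\<Prod>e\<in>A. 1 - z e)" if "A \<subseteq> E" for A
    using that z unfolding prod.distrib[symmetric] by (auto intro!: prod.cong simp: algebra_simps)
  { assume H: "H \<subseteq> E"
    show "\<delta> H * \<delta> H = \<delta> H"
    proof -
      have "\<delta> H * \<delta> H = (prod z H * prod z H) * ((\<Prod>e\<in>E - H. 1 - z e) * (\<Prod>e\<in>E - H. 1 - z e))"
        unfolding \<delta>_def by (simp only: ac_simps)
      then show ?thesis using P[OF H] Q[of "E - H"] by (simp add: \<delta>_def)
    qed
    assume F: "F \<subseteq> E"
    show "prod z F * \<delta> H = (if F \<subseteq> H then \<delta> H else 0)"
    proof (cases "F \<subseteq> H")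
      case True
      then have "prod z H = prod z F * prod z (H - F)"
        using prod.subset_diff[of F H z] H E finite_subset by (metis mult.commute)
      then have "prod z F * prod z H = prod z H" using P[OF F] by (metis mult.assoc)
      then show ?thesis using True by (simp add: \<delta>_def mult.assoc[symmetric])
    next
      case False
      then obtain e where e: "e \<in> F" "e \<notin> H" by blast
      then have eE: "e \<in> E - H" using F by blast
      have 1: "prod z F = z e * prod z (F - {e})"
        using e(1) F E finite_subset by (metis prod.remove)
      have 2: "(\<Prod>e\<in>E - H. 1 - z e) = (1 - z e) * (\<Prod>e\<in>E - H - {e}. 1 - z e)"
        using eE E by (metis finite_Diff prod.remove)
      have 0: "z e * (1 - z e) = 0" using z eE by (simp add: algebra_simps)
      have "prod z F * \<delta> H = (z e * (1 - z e)) * (prod z (F - {e}) * prod z H * (\<Prod>e\<in>E - H - {e}. 1 - z e))"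
        unfolding \<delta>_def 1 2 by (simp only: ac_simps)
      then show ?thesis using False 0 by simp
    qed }
qed

lemma fully_labeled_prod:
  assumes "finite S"
  shows "fully_labeled k S = fully_labeled k {} * (\<Prod>e\<in>S. fully_labeled k {e})"
  using assms
proof induction
  case (insert e S)
  have "fully_labeled k (insert e S) = fully_labeled k {e} * fully_labeled k S"
    by (simp add: fully_labeled_mult)
  then show ?case using insert by (simp add: ac_simps)
qed simp

lemma fully_labeled_algebra_mult_edge:
  assumes "x \<in> \<A>\<^sup>0 k" "e \<in> pairs k"
  shows "x * fully_labeled k {e} \<in> \<A>\<^sup>0 k"
proof -
  obtain c where c: "x = (\<Sum>S\<in>Pow (pairs k). c S *\<^sub>R fully_labeled k S)"
    using assms(1) in_span_image_finite[of "Pow (pairs k)" x "fully_labeled k"]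
    by (auto simp: fully_labeled_algebra_conv)
  have "x * fully_labeled k {e} = (\<Sum>S\<in>Pow (pairs k). c S *\<^sub>R fully_labeled k (S \<union> {e}))"
    by (simp only: c sum_distrib_right scaleR_mult_poly_mapping fully_labeled_mult)
  also have "\<dots> \<in> \<A>\<^sup>0 k"
    unfolding fully_labeled_algebra_conv using assms(2)
    by (intro span_sum span_scale span_base) auto
  finally show ?thesis .
qed

text \<open>The hypothesis says that the element, viewed as a function on the graphs \<open>H\<close> on \<open>{..<k}\<close>, is
  nonnegative.  The atoms \<open>\<delta> H\<close> are formed with the unit \<open>1\<close> of the large algebra, the empty graph;
  multiplying them by \<open>?u\<close>, the unit of \<open>\<A>\<^sup>0 k\<close>, moves them into \<open>\<A>\<^sup>0 k\<close>.\<close>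

lemma nonneg_on_cube_imp_sum_of_squares:
  assumes F: "\<And>i. i \<in> I \<Longrightarrow> F i \<subseteq> pairs k"
    and nonneg: "\<And>H. H \<subseteq> pairs k \<Longrightarrow> (\<Sum>i\<in>I. if F i \<subseteq> H then w i else 0) \<ge> 0"
  shows "(\<Sum>i\<in>I. w i *\<^sub>R fully_labeled k (F i)) \<in> \<Sigma>\<^sup>2 (\<A>\<^sup>0 k)"
proof -
  let ?E = "pairs k"
  let ?z = "\<lambda>e. fully_labeled k {e}"
  let ?u = "fully_labeled k {}"
  define \<delta> where "\<delta> H = prod ?z H * (\<Prod>e\<in>?E - H. 1 - ?z e)" for H
  note atoms = idempotent_atoms[of ?E ?z, folded \<delta>_def]
  have z: "?z e * ?z e = ?z e" for e by (simp add: fully_labeled_mult)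
  have uu: "?u * ?u = ?u" by (simp add: fully_labeled_mult)
  have in_alg: "?u * \<delta> H \<in> \<A>\<^sup>0 k" if "H \<subseteq> ?E" for H
  proof -
    have 1: "x * prod ?z A \<in> \<A>\<^sup>0 k" if "finite A" "A \<subseteq> ?E" "x \<in> \<A>\<^sup>0 k" for A x
      using that
    proof (induction A arbitrary: x)
      case (insert e A)
      then show ?case
        using fully_labeled_algebra_mult_edge[of x k e] by (simp add: mult.assoc[symmetric])
    qed simp
    have 2: "x * (\<Prod>e\<in>A. 1 - ?z e) \<in> \<A>\<^sup>0 k" if "finite A" "A \<subseteq> ?E" "x \<in> \<A>\<^sup>0 k" for A x
      using that
    proof (induction A arbitrary: x)
      case (insert e A)
      have "x - x * ?z e \<in> \<A>\<^sup>0 k"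
        using insert.prems fully_labeled_algebra_mult_edge[of x k e]
        by (auto simp: fully_labeled_algebra_conv intro: span_diff)
      then show ?case
        using insert by (simp add: mult.assoc[symmetric] right_diff_distrib)
    qed simp
    have "?u \<in> \<A>\<^sup>0 k" unfolding fully_labeled_algebra_conv by (intro span_base) auto
    then show ?thesis
      using 1[of H ?u] 2[of "?E - H" "?u * prod ?z H"] that finite_subset[OF that]
      by (simp add: \<delta>_def mult.assoc)
  qed
  have expand: "fully_labeled k S = (\<Sum>H\<in>Pow ?E. (if S \<subseteq> H then 1 else 0) *\<^sub>R (?u * \<delta> H))"
    if S: "S \<subseteq> ?E" for S
  proof -
    have "fully_labeled k S = ?u * prod ?z S * (\<Sum>H\<in>Pow ?E. \<delta> H)"
      using fully_labeled_prod[of S k] finite_subset[OF S] atoms(1) z by simp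
    also have "\<dots> = (\<Sum>H\<in>Pow ?E. ?u * (prod ?z S * \<delta> H))"
      by (simp only: sum_distrib_left mult.assoc)
    also have "\<dots> = (\<Sum>H\<in>Pow ?E. (if S \<subseteq> H then 1 else 0) *\<^sub>R (?u * \<delta> H))"
      using S z by (intro sum.cong refl) (simp add: atoms(3))
    finally show ?thesis .
  qed
  define f where "f H = (\<Sum>i\<in>I. if F i \<subseteq> H then w i else 0)" for H
  have "(\<Sum>i\<in>I. w i *\<^sub>R fully_labeled k (F i))
      = (\<Sum>i\<in>I. \<Sum>H\<in>Pow ?E. (if F i \<subseteq> H then w i else 0) *\<^sub>R (?u * \<delta> H))"
    by (intro sum.cong refl, subst expand[OF F]) (auto simp: scaleR_sum_right intro!: sum.cong)
  also have "\<dots> = (\<Sum>H\<in>Pow ?E. f H *\<^sub>R (?u * \<delta> H))"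
    by (subst sum.swap) (simp add: f_def scaleR_sum_left)
  also have "\<dots> = (\<Sum>H\<in>Pow ?E. (sqrt (f H) *\<^sub>R (?u * \<delta> H))\<^sup>2)"
  proof (intro sum.cong refl)
    fix H assume "H \<in> Pow ?E"
    then have H: "H \<subseteq> ?E" by simp
    have "(?u * \<delta> H) * (?u * \<delta> H) = (?u * ?u) * (\<delta> H * \<delta> H)" by (simp only: ac_simps)
    also have "\<dots> = ?u * \<delta> H" using atoms(2)[of H] z uu H by simp
    finally have "(?u * \<delta> H) * (?u * \<delta> H) = ?u * \<delta> H" .
    moreover have "f H \<ge> 0" using nonneg[OF H] by (simp add: f_def)
    ultimately show "f H *\<^sub>R (?u * \<delta> H) = (sqrt (f H) *\<^sub>R (?u * \<delta> H))\<^sup>2"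
      by (simp add: power2_eq_square scaleR_mult_poly_mapping)
  qed
  finally have eq: "(\<Sum>i\<in>I. w i *\<^sub>R fully_labeled k (F i))
    = (\<Sum>H\<in>Pow ?E. (sqrt (f H) *\<^sub>R (?u * \<delta> H))\<^sup>2)" .
  obtain Hs where Hs: "set Hs = Pow ?E" "distinct Hs"
    using finite_distinct_list[of "Pow ?E"] by auto
  let ?xs = "map (\<lambda>H. sqrt (f H) *\<^sub>R (?u * \<delta> H)) Hs"
  have "(\<Sum>H\<in>Pow ?E. (sqrt (f H) *\<^sub>R (?u * \<delta> H))\<^sup>2) = (\<Sum>x\<leftarrow>?xs. x\<^sup>2)"
    unfolding Hs(1)[symmetric] by (simp add: sum_list_distinct_conv_sum_set[OF Hs(2)] o_def)
  moreover have "set ?xs \<subseteq> \<A>\<^sup>0 k"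
    using Hs(1) in_alg by (auto simp: fully_labeled_algebra_conv intro!: span_scale)
  ultimately show ?thesis unfolding eq sums_of_squares_def by blast
qed

section \<open>Injective and ordinary densities\<close>

definition injections :: "nat \<Rightarrow> nat \<Rightarrow> (nat \<Rightarrow> nat) set" where
  "injections n k = {p \<in> {..<n} \<rightarrow>\<^sub>E {..<k}. inj_on p {..<n}}"

lemma finite_injections [simp]: "finite (injections n k)"
  unfolding injections_def by (rule finite_subset[OF _ finite_PiE[of "{..<n}" "\<lambda>_. {..<k}"]]) auto

text \<open>For \<open>i \<ge> k\<close> the truncated factor \<open>k - i\<close> is harmless: if \<open>n > k\<close>, the factor for \<open>i = k\<close> is
  \<open>0\<close>, and there are no injections.\<close>

lemma card_injections: "card (injections n k) = (\<Prod>i<n. k - i)"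
  using card_inj_on_subset_funcset[of "{..<n}" "{..<k}" "{..<n}"]
  by (simp add: injections_def atLeast0LessThan)

lemma card_injections_asymp: "(\<lambda>k. card (injections n k) / real k ^ n) \<longlonglongrightarrow> 1"
proof -
  have "(\<lambda>k. \<Prod>i<n. 1 - real i / real k) \<longlonglongrightarrow> (\<Prod>i<n. 1 - 0)"
    by (intro tendsto_prod tendsto_diff tendsto_const lim_const_over_n)
  moreover have "eventually (\<lambda>k. (\<Prod>i<n. 1 - real i / real k) = card (injections n k) / real k ^ n) sequentially"
    using eventually_ge_at_top[of "Suc n"]
  proof eventually_elim
    case (elim k)
    have "(\<Prod>i<n. 1 - real i / real k) = (\<Prod>i<n. real (k - i) / real k)"
      using elim by (intro prod.cong) (auto simp: of_nat_diff field_simps)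
    then show ?case by (simp add: card_injections prod_dividef)
  qed
  ultimately show ?thesis by (simp add: tendsto_cong)
qed

text \<open>Let \<open>h\<close> of the \<open>N\<close> injections and \<open>r\<close> of the \<open>R\<close> noninjective maps preserve edges.  Then
  \<open>h/N - (h + r)/(N + R) = (R h/N - r)/(N + R)\<close>, where both \<open>R h/N\<close> and \<open>r\<close> lie between \<open>0\<close> and
  \<open>R\<close>.\<close>

lemma injective_density_approx:
  assumes k: "n \<le> k" "0 < k"
  shows "\<bar>card (injections n k \<inter> edge_maps n S k T) / card (injections n k)
      - card (edge_maps n S k T) / real k ^ n\<bar> \<le> 1 - card (injections n k) / real k ^ n"
proof -
  let ?M = "{..<n} \<rightarrow>\<^sub>E {..<k}"
  let ?I = "injections n k" and ?E = "edge_maps n S k T"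
  have fin: "finite ?M" by (intro finite_PiE) auto
  have sub: "?I \<subseteq> ?M" "?E \<subseteq> ?M" by (auto simp: injections_def edge_maps_def)
  have M: "real (card ?M) = real k ^ n" by (simp add: card_funcsetE)
  have N: "0 < card ?I" using k by (auto simp: card_injections intro!: prod_pos)
  define N r h R where "N = real (card ?I)" and "r = real (card (?E - ?I))"
    and "h = real (card (?I \<inter> ?E))" and "R = real (card (?M - ?I))"
  have "card ?E = card (?I \<inter> ?E) + card (?E - ?I)"
    using card_Int_Diff[of ?E ?I] by (simp add: Int_commute)
  then have E: "real (card ?E) = h + r" by (simp add: h_def r_def)
  have "card ?M = card ?I + card (?M - ?I)"
    using card_Int_Diff[OF fin, of ?I] sub by (simp add: Int_absorb1)
  then have K: "real k ^ n = N + R" using M by (simp add: N_def R_def)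
  have rR: "0 \<le> r" "r \<le> R" unfolding r_def R_def using sub fin by (auto intro!: card_mono)
  have hN: "0 \<le> h" "h \<le> N" unfolding h_def N_def by (auto intro!: card_mono)
  have Np: "0 < N" using N by (simp add: N_def)
  have pos: "0 < N + R" using Np rR by simp
  have "h / N - (h + r) / (N + R) = (h / N * R - r) / (N + R)"
    using Np pos by (simp add: field_simps)
  moreover have "0 \<le> h / N * R" "h / N * R \<le> R"
    using hN Np rR by (auto intro!: mult_left_le_one_le simp del: times_divide_eq_left)
  then have "\<bar>h / N * R - r\<bar> \<le> R" using rR by linarith
  ultimately have "\<bar>h / N - (h + r) / (N + R)\<bar> \<le> R / (N + R)"
    using pos by (simp add: divide_right_mono)
  also have "\<dots> = 1 - N / (N + R)" using pos by (simp add: field_simps)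
  finally show ?thesis by (simp add: E K N_def[symmetric] h_def[symmetric])
qed

section \<open>Averaging over labeled copies\<close>

lemma image_injection_pairs:
  assumes "p \<in> injections n k" "S \<subseteq> pairs n"
  shows "(`) p ` S \<subseteq> pairs k"
proof (rule image_subsetI)
  fix e assume "e \<in> S"
  then have e: "e \<subseteq> {..<n}" "card e = 2" using assms(2) by (auto simp: pairs_def)
  have p: "inj_on p {..<n}" "p ` {..<n} \<subseteq> {..<k}" using assms(1) by (auto simp: injections_def)
  have "inj_on p e" using p(1) e(1) by (rule inj_on_subset)
  then show "p ` e \<in> pairs k" using e p(2) by (auto simp: pairs_def card_image)
qed

text \<open>A copy of a graph on \<open>n\<close> vertices inside \<open>{..<k}\<close> is, without its labels, the graph itself
  together with \<open>k - n\<close> isolated vertices, which are added one at a time.\<close>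

lemma unlabeled_copy_mod_isolated:
  assumes p: "p \<in> injections n k" and S: "S \<subseteq> pairs n"
  shows "Poly_Mapping.single (unlabeled_on n S) 1 - unlabel_linear (fully_labeled k ((`) p ` S))
    \<in> span {Poly_Mapping.single (G + K1) 1 - Poly_Mapping.single G 1 |G. G \<in> \<G> 0}"
    (is "_ \<in> span ?Z")
proof -
  have p': "inj_on p {..<n}" "p ` {..<n} \<subseteq> {..<k}" using p by (auto simp: injections_def)
  have "n \<le> k" using card_inj_on_le[OF p'] by simp
  then have "Poly_Mapping.single (unlabeled_on k S) (1::real) - Poly_Mapping.single (unlabeled_on n S) 1
      \<in> span ?Z"
  proof (induction rule: dec_induct)
    case base
    then show ?case by (simp add: span_zero)
  next
    case (step m)
    have "S \<subseteq> pairs m" using S pairs_mono[OF step.hyps(1)] by blast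
    then have "Poly_Mapping.single (unlabeled_on (Suc m) S) (1::real) - Poly_Mapping.single (unlabeled_on m S) 1 \<in> ?Z"
      by (auto simp: unlabeled_on_add_K1 labeled_graphs_def intro!: exI[of _ "unlabeled_on m S"])
    from span_add[OF span_base[OF this] step.IH] show ?case by simp
  qed
  from span_neg[OF this] show ?thesis
    by (simp add: unlabel_linear_conv unlabeled_on_inj_image[OF p' S])
qed

text \<open>The lift of \<open>b\<close> is \<open>\<sigma> = \<Sum>\<^sub>F b\<^sub>F / N\<^sub>F \<Sum>\<^sub>p p(F)\<close>, where \<open>p\<close> runs through the \<open>N\<^sub>F\<close> injections of
  the vertices of \<open>F\<close> into \<open>{..<k}\<close>.  Its value at \<open>H\<close> is the combination of the injective
  densities into \<open>H\<close>, and the lower bound \<open>\<epsilon>\<close> on the combination of the ordinary densities leaves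
  room for the difference.\<close>

lemma coincides_with_sum_of_squares:
  assumes b: "b \<in> \<A> 0" and \<epsilon>: "\<epsilon> > 0"
    and pos: "\<And>G. num_labels G = 0 \<Longrightarrow> num_verts G \<noteq> 0 \<Longrightarrow> linear_extension (\<lambda>F. hom_density F G) b \<ge> \<epsilon>"
  shows "\<exists>k. \<exists>\<sigma>\<in>\<Sigma>\<^sup>2 (\<A>\<^sup>0 k). coincide b \<sigma>"
proof -
  define K where "K = Poly_Mapping.keys b"
  define c where "c = Poly_Mapping.lookup b"
  have K: "finite K" by (simp add: K_def)
  define n where "n = num_verts"
  define N where "N F k = real (card (injections (n F) k))" for F k
  \<comment> \<open>\<open>S F\<close> is the edge set of a representative of \<open>F\<close> on the vertices \<open>{..<n F}\<close>\<close>
  have "\<forall>F\<in>K. \<exists>S\<subseteq>pairs (n F). F = unlabeled_on (n F) S"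
    using b unlabeled_on_exhaust by (auto simp: labeled_algebra_def labeled_graphs_def K_def n_def)
  then obtain S where S: "\<And>F. F \<in> K \<Longrightarrow> S F \<subseteq> pairs (n F)"
      "\<And>F. F \<in> K \<Longrightarrow> F = unlabeled_on (n F) (S F)"
    by metis
  have "(\<lambda>k. \<Sum>F\<in>K. \<bar>c F\<bar> * (1 - N F k / real k ^ n F)) \<longlonglongrightarrow> (\<Sum>F\<in>K. \<bar>c F\<bar> * (1 - 1))"
    unfolding N_def by (intro tendsto_intros card_injections_asymp)
  then have "\<forall>\<^sub>F k in sequentially. (\<Sum>F\<in>K. \<bar>c F\<bar> * (1 - N F k / real k ^ n F)) < \<epsilon>"
    using \<epsilon> by (intro order_tendstoD(2)) auto
  moreover have "\<forall>\<^sub>F k in sequentially. \<forall>F\<in>K. n F \<le> k"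
    using K by (simp add: eventually_ball_finite_distrib eventually_ge_at_top)
  moreover have "\<forall>\<^sub>F k in sequentially. 0 < k" by (rule eventually_gt_at_top)
  ultimately have "\<forall>\<^sub>F k in sequentially. (\<Sum>F\<in>K. \<bar>c F\<bar> * (1 - N F k / real k ^ n F)) < \<epsilon>
      \<and> (\<forall>F\<in>K. n F \<le> k) \<and> 0 < k"
    by (intro eventually_conj)
  \<comment> \<open>\<open>0 < k\<close> is needed because the densities into the graph without vertices are not controlled\<close>
  then obtain k where k: "(\<Sum>F\<in>K. \<bar>c F\<bar> * (1 - N F k / real k ^ n F)) < \<epsilon>"
      "\<And>F. F \<in> K \<Longrightarrow> n F \<le> k" "0 < k"
    by (auto dest!: eventually_happens)
  have N: "N F k > 0" if "F \<in> K" for F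
    using k(2)[OF that] by (auto simp: N_def card_injections intro!: prod_pos)
  define I where "I = Sigma K (\<lambda>F. injections (n F) k)"
  define w where "w = (\<lambda>(F, p :: nat \<Rightarrow> nat). c F / N F k)"
  define E where "E = (\<lambda>(F, p :: nat \<Rightarrow> nat). (`) p ` S F)"
  define \<sigma> where "\<sigma> = (\<Sum>i\<in>I. w i *\<^sub>R fully_labeled k (E i))"
  have "\<sigma> \<in> \<Sigma>\<^sup>2 (\<A>\<^sup>0 k)" unfolding \<sigma>_def
  proof (rule nonneg_on_cube_imp_sum_of_squares)
    show "E i \<subseteq> pairs k" if "i \<in> I" for i
      using that image_injection_pairs S(1) by (fastforce simp: I_def E_def)
    fix H assume H: "H \<subseteq> pairs k"
    \<comment> \<open>the ordinary and the injective density of \<open>F\<close> in the graph \<open>H\<close>\<close>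
    define d where "d F = hom_density F (unlabeled_on k H)" for F
    define d' where "d' F = card (injections (n F) k \<inter> edge_maps (n F) (S F) k H) / N F k" for F
    have eval: "(\<Sum>i\<in>I. if E i \<subseteq> H then w i else 0) = (\<Sum>F\<in>K. c F * d' F)"
    proof -
      have inner: "(\<Sum>p\<in>injections (n F) k. if E (F, p) \<subseteq> H then w (F, p) else 0) = c F * d' F" for F
      proof -
        have "injections (n F) k \<inter> {p. E (F, p) \<subseteq> H} = injections (n F) k \<inter> edge_maps (n F) (S F) k H"
          by (auto simp: injections_def edge_maps_def E_def)
        then show ?thesis by (simp add: sum.If_cases w_def d'_def)
      qed
      have "(\<Sum>F\<in>K. c F * d' F)
          = (\<Sum>F\<in>K. \<Sum>p\<in>injections (n F) k. if E (F, p) \<subseteq> H then w (F, p) else 0)"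
        by (simp add: inner)
      also have "\<dots> = (\<Sum>i\<in>I. if E i \<subseteq> H then w i else 0)"
        unfolding I_def using K by (simp add: sum.Sigma split_def cong: if_cong)
      finally show ?thesis by simp
    qed
    have close: "\<bar>d' F - d F\<bar> \<le> 1 - N F k / real k ^ n F" if F: "F \<in> K" for F
    proof -
      have "d F = card (edge_maps (n F) (S F) k H) / real k ^ n F"
        using hom_density_unlabeled_on[OF S(1)[OF F] H] S(2)[OF F] by (simp add: d_def)
      then show ?thesis
        using injective_density_approx[OF k(2)[OF F] k(3)] by (simp add: d'_def N_def)
    qed
    have "(\<Sum>F\<in>K. c F * d F) = linear_extension (\<lambda>F. hom_density F (unlabeled_on k H)) b"
      by (simp add: linear_extension_def K_def c_def d_def)
    then have "\<epsilon> \<le> (\<Sum>F\<in>K. c F * d F)" using pos[of "unlabeled_on k H"] k(3) by simp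
    moreover have "(\<Sum>F\<in>K. c F * d F) - (\<Sum>F\<in>K. c F * d' F) \<le> (\<Sum>F\<in>K. \<bar>c F\<bar> * (1 - N F k / real k ^ n F))"
      unfolding sum_subtractf[symmetric]
    proof (rule sum_mono)
      fix F assume F: "F \<in> K"
      have "c F * d F - c F * d' F \<le> \<bar>c F * d F - c F * d' F\<bar>" by simp
      also have "\<dots> = \<bar>c F\<bar> * \<bar>d' F - d F\<bar>"
        by (simp add: right_diff_distrib[symmetric] abs_mult abs_minus_commute)
      also have "\<dots> \<le> \<bar>c F\<bar> * (1 - N F k / real k ^ n F)"
        using close[OF F] by (intro mult_left_mono) auto
      finally show "c F * d F - c F * d' F \<le> \<bar>c F\<bar> * (1 - N F k / real k ^ n F)" .
    qed
    ultimately show "(\<Sum>i\<in>I. if E i \<subseteq> H then w i else 0) \<ge> 0" using k(1) eval by linarith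
  qed
  moreover have "coincide b \<sigma>"
  proof -
    have lin: "linear unlabel_linear" by (rule linear_unlabel_linear)
    have "unlabel_linear b = (\<Sum>F\<in>K. c F *\<^sub>R Poly_Mapping.single F 1)"
      using poly_mapping_conv_sum[of b] by (simp add: unlabel_linear_unlabeled[OF b] K_def c_def)
    also have "\<dots> = (\<Sum>F\<in>K. \<Sum>p\<in>injections (n F) k. w (F, p) *\<^sub>R Poly_Mapping.single F 1)"
    proof (rule sum.cong[OF refl])
      fix F assume "F \<in> K"
      from N[OF this] show "c F *\<^sub>R Poly_Mapping.single F 1
          = (\<Sum>p\<in>injections (n F) k. w (F, p) *\<^sub>R Poly_Mapping.single F (1::real))"
        unfolding scaleR_sum_left[symmetric] by (auto simp: w_def N_def)
    qed
    also have "\<dots> = (\<Sum>i\<in>I. w i *\<^sub>R Poly_Mapping.single (fst i) 1)"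
      unfolding I_def using K by (simp add: sum.Sigma split_def)
    finally have "unlabel_linear b - unlabel_linear \<sigma>
      = (\<Sum>i\<in>I. w i *\<^sub>R (Poly_Mapping.single (fst i) 1 - unlabel_linear (fully_labeled k (E i))))"
      by (simp add: \<sigma>_def linear_sum[OF lin] linear_scale[OF lin] sum_subtractf scaleR_diff_right)
    also have "\<dots> \<in> span {Poly_Mapping.single (G + K1) 1 - Poly_Mapping.single G 1 |G. G \<in> \<G> 0}"
    proof (intro span_sum span_scale)
      fix i assume "i \<in> I"
      then obtain F p where i: "i = (F, p)" "F \<in> K" "p \<in> injections (n F) k" by (auto simp: I_def)
      show "Poly_Mapping.single (fst i) 1 - unlabel_linear (fully_labeled k (E i))
          \<in> span {Poly_Mapping.single (G + K1) 1 - Poly_Mapping.single G 1 |G. G \<in> \<G> 0}"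
        using unlabeled_copy_mod_isolated[OF i(3) S(1)[OF i(2)]] S(2)[OF i(2)] by (simp add: i(1) E_def)
    qed
    finally show ?thesis by (simp add: coincide_def)
  qed
  ultimately show ?thesis by blast
qed

section \<open>The weak Positivstellensatz\<close>

lemma nonneg_quantum_graph_conv:
  "nonneg_quantum_graph a \<longleftrightarrow>
    (\<forall>G. num_labels G = 0 \<longrightarrow> num_verts G \<noteq> 0 \<longrightarrow> linear_extension (\<lambda>F. hom_density F G) a \<ge> 0)"
  by (auto simp: nonneg_quantum_graph_def linear_extension_def labeled_graphs_def)

lemma num_labels_zero: "num_labels 0 = 0"
  by transfer simp

lemma hom_density_empty: "hom_density 0 G = 1"
proof -
  have "num_homs 0 G = 1" by transfer (simp add: hom_count_def)
  moreover have "num_verts 0 = 0" by transfer simp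
  ultimately show ?thesis by (simp add: hom_density_def)
qed

theorem theorem2p3:
  fixes a :: "lgraph \<Rightarrow>\<^sub>0 real"
  assumes "a \<in> \<A> 0"
  shows "nonneg_quantum_graph a \<longleftrightarrow>
    (\<forall>\<epsilon>>0. \<exists>k. \<exists>\<sigma>\<in>\<Sigma>\<^sup>2 (\<A>\<^sup>0 k). coincide (a + \<epsilon> *\<^sub>R 1) \<sigma>)"
proof -
  let ?t = "\<lambda>G. linear_extension (\<lambda>F. hom_density F G)"
  have t1: "?t G 1 = 1" for G
    using linear_extension_single[of "\<lambda>F. hom_density F G" 0 1] by (simp add: hom_density_empty)
  have t: "?t G (a + \<epsilon> *\<^sub>R 1) = ?t G a + \<epsilon>" for \<epsilon> G
    by (simp add: linear_add[OF linear_linear_extension] linear_scale[OF linear_linear_extension] t1)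
  have b: "a + \<epsilon> *\<^sub>R 1 \<in> \<A> 0" for \<epsilon>
  proof -
    have "Poly_Mapping.keys (a + \<epsilon> *\<^sub>R 1) \<subseteq> insert 0 (Poly_Mapping.keys a)"
      by (auto simp: in_keys_iff lookup_add lookup_scaleR lookup_one when_def split: if_splits)
    then show ?thesis
      using assms num_labels_zero by (auto simp: labeled_algebra_def labeled_graphs_def)
  qed
  show ?thesis
  proof (intro iffI allI impI)
    fix \<epsilon> :: real assume "nonneg_quantum_graph a" and \<epsilon>: "\<epsilon> > 0"
    then have "?t G (a + \<epsilon> *\<^sub>R 1) \<ge> \<epsilon>" if "num_labels G = 0" "num_verts G \<noteq> 0" for G
      using that by (simp add: nonneg_quantum_graph_conv t)
    then show "\<exists>k. \<exists>\<sigma>\<in>\<Sigma>\<^sup>2 (\<A>\<^sup>0 k). coincide (a + \<epsilon> *\<^sub>R 1) \<sigma>"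
      by (rule coincides_with_sum_of_squares[OF b \<epsilon>])
  next
    assume *: "\<forall>\<epsilon>>0. \<exists>k. \<exists>\<sigma>\<in>\<Sigma>\<^sup>2 (\<A>\<^sup>0 k). coincide (a + \<epsilon> *\<^sub>R 1) \<sigma>"
    have "?t G a \<ge> 0" if G: "num_labels G = 0" "num_verts G \<noteq> 0" for G
    proof (rule field_le_epsilon)
      fix \<epsilon> :: real assume "\<epsilon> > 0"
      then obtain k \<sigma> where \<sigma>: "\<sigma> \<in> \<Sigma>\<^sup>2 (\<A>\<^sup>0 k)" "coincide (a + \<epsilon> *\<^sub>R 1) \<sigma>" using * by blast
      obtain xs where xs: "\<sigma> = (\<Sum>x\<leftarrow>xs. x\<^sup>2)" "set xs \<subseteq> \<A>\<^sup>0 k"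
        using \<sigma>(1) by (auto simp: sums_of_squares_def)
      have "?t G (unlabel_linear (\<Sum>x\<leftarrow>xs. x\<^sup>2)) \<ge> 0"
        using xs(2)
      proof (induction xs)
        case Nil
        then show ?case
          by (simp add: linear_0[OF linear_unlabel_linear] linear_0[OF linear_linear_extension])
      next
        case (Cons x xs)
        then show ?case
          using square_density_nonneg[of x k G] G(1)
          by (simp add: linear_add[OF linear_unlabel_linear] linear_add[OF linear_linear_extension])
      qed
      then show "0 \<le> ?t G a + \<epsilon>"
        using coincide_density[OF \<sigma>(2) G] unlabel_linear_unlabeled[OF b] xs(1) by (simp add: t)
    qed
    then show "nonneg_quantum_graph a" by (simp add: nonneg_quantum_graph_conv)
  qed
qed

end
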